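(* Let $a,b,s,t$ be positive integers with $r=a+b$, $b<a<r-1$ and $t\le s$. Let $T$ be a tree with bipartition $(U,V)$, $|U|=s$, $|V|=t$, and $\mathcal T=T(a,b)$. Suppose $T$ has a critical leaf, i.e. a vertex $x\in V$ with $\deg_T(x)=1$. Let $(H_n)$ be a sequence where $H_n$ is a $\mathcal T$-free $r$-graph on $n$ vertices and $|H_n|=(1+o(1))(t-1)\binom{n}{r-1}$ as $n\to\infty$. Then there exist sets $S_n$ of $t-1$ vertices of $H_n$ such that the number of edges of $H_n$ disjoint from $S_n$ is $o(n^{r-1})$.
   Context: An $r$-graph is a family of $r$-subsets of a finite vertex set. For a bipartite graph $T$ with parts $U=\{u_1,\dots,u_s\}$, $V=\{v_1,\dots,v_t\}$, the $(a,b)$-blowup $T(a,b)$ is the $(a+b)$-graph obtained by taking pairwise disjoint sets $U_1,\dots,U_s,V_1,\dots,V_t$ with $|U_i|=a$, $|V_j|=b$ and edge set $\{U_i\cup V_j:u_iv_j\in E(T)\}$; $H$ is $\mathcal T$-free if it contains no copy of $\mathcal T$. *)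

theory Defs
  imports
    Complex_Main
    "HOL-Library.Landau_Symbols"
    "Graph_Theory.Digraph_Component"
begin

text \<open>
  A finite simple graph is a \<^locale>\<open>pair_graph\<close>: a finite loop-free digraph with a
  symmetric arc set, in which an undirected edge is a pair of opposite arcs.  The predicate
  \<^const>\<open>tree\<close> cannot be used for such graphs, because an arc followed by its opposite is
  a cycle in the sense of \<^const>\<open>pre_digraph.cycle\<close>.  The cycles of the undirected graph
  are the ones of length at least 3.
\<close>

definition undirected_tree :: "'v pair_pre_digraph \<Rightarrow> bool" where
  "undirected_tree T \<longleftrightarrow>
     pair_graph T \<and>
     Digraph_Component.connected (with_proj T) \<and>
     \<not> (\<exists>p. pre_digraph.cycle (with_proj T) p \<and> 3 \<le> length p)"

definition bipartition :: "'v pair_pre_digraph \<Rightarrow> 'v set \<Rightarrow> 'v set \<Rightarrow> bool" where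
  "bipartition T U V \<longleftrightarrow>
     U \<union> V = pverts T \<and> U \<inter> V = {} \<and>
     (\<forall>(x, y) \<in> parcs T. (x \<in> U \<and> y \<in> V) \<or> (x \<in> V \<and> y \<in> U))"

text \<open>A hypergraph is given by its vertex set \<open>W\<close> and its edge family \<open>H\<close>.\<close>

definition uniform_hypergraph :: "nat \<Rightarrow> 'w set \<Rightarrow> 'w set set \<Rightarrow> bool" where
  "uniform_hypergraph r W H \<longleftrightarrow> finite W \<and> (\<forall>e\<in>H. e \<subseteq> W \<and> card e = r)"

text \<open>
  In the \<open>(a, b)\<close>-blowup, the set replacing a vertex \<open>u \<in> U\<close> is \<open>{u} \<times> {..<a}\<close> and the set
  replacing a vertex \<open>v \<in> V\<close> is \<open>{v} \<times> {..<b}\<close>.  These are pairwise disjoint when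
  \<open>U \<inter> V = {}\<close>.
\<close>

definition blowup_verts :: "nat \<Rightarrow> nat \<Rightarrow> 'v set \<Rightarrow> 'v set \<Rightarrow> ('v \<times> nat) set" where
  "blowup_verts a b U V = U \<times> {..<a} \<union> V \<times> {..<b}"

definition blowup_edges ::
  "nat \<Rightarrow> nat \<Rightarrow> 'v pair_pre_digraph \<Rightarrow> 'v set \<Rightarrow> 'v set \<Rightarrow> ('v \<times> nat) set set" where
  "blowup_edges a b T U V =
     {{u} \<times> {..<a} \<union> {v} \<times> {..<b} | u v. u \<in> U \<and> v \<in> V \<and> (u, v) \<in> parcs T}"

definition contains_copy :: "'w set \<Rightarrow> 'w set set \<Rightarrow> 'x set \<Rightarrow> 'x set set \<Rightarrow> bool" where
  "contains_copy W H X F \<longleftrightarrow>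
     (\<exists>f. inj_on f X \<and> f ` X \<subseteq> W \<and> (\<forall>e\<in>F. f ` e \<in> H))"

definition blowup_free ::
  "nat \<Rightarrow> nat \<Rightarrow> 'v pair_pre_digraph \<Rightarrow> 'v set \<Rightarrow> 'v set \<Rightarrow> 'w set \<Rightarrow> 'w set set \<Rightarrow> bool" where
  "blowup_free a b T U V W H \<longleftrightarrow>
     \<not> contains_copy W H (blowup_verts a b U V) (blowup_edges a b T U V)"

text \<open>In a symmetric digraph the out-degree is the degree of the undirected graph.\<close>

definition critical_leaf :: "'v pair_pre_digraph \<Rightarrow> 'v set \<Rightarrow> 'v \<Rightarrow> bool" where
  "critical_leaf T V x \<longleftrightarrow> x \<in> V \<and> out_degree (with_proj T) x = 1"

end

theory Submission
  imports Defs "HOL-Library.FuncSet" "HOL-Real_Asymp.Real_Asymp"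
begin

text \<open>
  Let \<open>m = r - 1\<close> and \<open>n = card W\<close>.  Since a hypergraph with large codegrees contains the blowup, every
  edge \<open>e\<close> of a blowup-free \<open>H\<close> can be given a centre \<open>c \<in> e\<close> such that each \<open>m\<close>-set \<open>Y\<close> has a
  bounded number of centres, i.e. arises boundedly often as \<open>e - {c}\<close>.

  The main step is that only \<open>O(n ^ m)\<close> of the \<open>n ^ (m + 1)\<close> ways to exchange one vertex of an \<open>m\<close>-set
  \<open>Y\<close> with at least \<open>t - 1\<close> centres create a centre outside \<open>t - 1\<close> given centres of \<open>Y\<close>.  The
  configurations consisting of \<open>Y\<close>, the new vertex, the \<open>t - 1\<close> centres and the new centre are
  determined by \<open>m + 1\<close> vertices.  If there are more than \<open>O(n ^ m)\<close> of them, a homogeneous subfamily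
  has no spanning set of \<open>m\<close> positions.  This rank condition keeps the closures of the
  relevant position sets small, so that the tree can be embedded greedily, the critical leaf using the
  new centre and the other \<open>t - 1\<close> vertices of \<open>V\<close> the old ones.

  Consequently almost no \<open>m\<close>-set has \<open>t\<close> or more centres, so by the edge count almost all have exactly
  \<open>t - 1\<close>, and almost all pairs of \<open>m\<close>-sets have the same centres.  The common set of centres is the
  required \<open>S\<close>.
\<close>

section \<open>Embedding blowups of trees\<close>

text \<open>A centre may be determined by the rest of its edge, as when all edges meet a small fixed
  set in one vertex; then it cannot be renewed while the tree grows. The vertices of
  \<open>V\<close> therefore need centre positions of their own, and \<open>t - 1\<close> common
  centres serve only \<open>V - {x}\<close>. The missing centre for \<open>x\<close> is what a
  change of centres under an exchange supplies. As \<open>x\<close> is a leaf, this new centre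
  enters just one edge of the embedded tree.

  Homogeneity turns "determined by" into a closure operator on positions: one part of an edge can be
  renewed while the other is kept if the closure of the kept part misses it. An edge has
  \<open>m + 1\<close> positions and no \<open>m - 1\<close> positions span \<open>Y\<close>, so the
  closure of a part can enter the other part in at most one position. Distributing the redundant
  positions so that no part holds exactly one of them uses \<open>b < a\<close> and
  \<open>2 \<le> b\<close>, the latter being \<open>a < r - 1\<close>. If the centre alone is
  redundant, a colouring of the vertices by positions keeps different centres apart.

  The bound on exchanges also limits the sets with \<open>t\<close> centres: Cauchy-Schwarz leaves a
  factor \<open>1 / sqrt n\<close>, which is enough.\<close>

lemma tree_growth_induct:
  assumes T: "undirected_tree T" and arc: "(x, u) \<in> parcs T"
    and base: "Q {x, u}"
    and step: "\<And>P p w. \<lbrakk>x \<in> P; u \<in> P; P \<subseteq> pverts T; p \<in> P; w \<in> pverts T; w \<notin> P; (p, w) \<in> parcs T;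
        \<And>p'. p' \<in> P \<Longrightarrow> (p', w) \<in> parcs T \<Longrightarrow> p' = p; Q P\<rbrakk> \<Longrightarrow> Q (insert w P)"
  shows "Q (pverts T)"
proof -
  interpret pair_graph T using T by (simp add: undirected_tree_def)
  have conn: "connected (with_proj T)" and acyc: "\<And>p. cycle p \<Longrightarrow> length p < 3"
    using T by (auto simp: undirected_tree_def not_le)
  have sym: "(v, w) \<in> parcs T" if "(w, v) \<in> parcs T" for v w
    using that pair_sym_arcs by (auto simp: symmetric_def sym_def)
  have reach: "v \<rightarrow>\<^sup>*\<^bsub>with_proj T\<^esub> w" if "v \<in> pverts T" "w \<in> pverts T" for v w
    using conn that reachable_mk_symmetric_eq[OF pair_sym_arcs]
    by (auto simp: connected_def strongly_connected_def)
  \<comment> \<open>Path-connectedness inside \<open>P\<close> makes the arc from \<open>P\<close>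
    to a new vertex unique: two such arcs and a path of \<open>P\<close> between their tails would
    close a cycle of length at least 3. As connectedness always provides an arc leaving
    \<open>P\<close>, a maximal \<open>good\<close> set is the whole tree.\<close>
  define conn_in where "conn_in P \<longleftrightarrow>
    (\<forall>p1\<in>P. \<forall>p2\<in>P. \<exists>q. apath p1 q p2 \<and> set (awalk_verts p1 q) \<subseteq> P)" for P
  define good where "good P \<longleftrightarrow> x \<in> P \<and> u \<in> P \<and> P \<subseteq> pverts T \<and> conn_in P \<and> Q P" for P
  have extend: "\<exists>P'. good P' \<and> P \<subset> P'" if P: "good P" "P \<noteq> pverts T" for P
  proof -
    from P have xP: "x \<in> P" "u \<in> P" "P \<subseteq> pverts T" "conn_in P" "Q P" by (auto simp: good_def)
    obtain y where y: "y \<in> pverts T" "y \<notin> P" using xP P by blast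
    have "x \<rightarrow>\<^sup>*\<^bsub>with_proj T\<^esub> y" using reach xP y by auto
    then have "\<exists>p w. p \<in> P \<and> w \<notin> P \<and> (p, w) \<in> parcs T"
      using y(2) by (induct rule: reachable_induct) (use xP in auto)
    then obtain p w where pw: "p \<in> P" "w \<notin> P" "(p, w) \<in> parcs T" by blast
    have wT: "w \<in> pverts T" using pw in_arcsD2 by blast
    have uniq: "p' = p" if p': "p' \<in> P" "(p', w) \<in> parcs T" for p'
    proof (rule ccontr)
      assume ne: "p' \<noteq> p"
      obtain q where q: "apath p q p'" "set (awalk_verts p q) \<subseteq> P"
        using xP(4) pw p' unfolding conn_in_def by blast
      let ?c = "(w, p) # q @ [(p', w)]"
      have aw: "awalk p q p'" and dq: "distinct (awalk_verts p q)"
        using q by (auto simp: apath_def)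
      have "awalk p (q @ [(p', w)]) w"
        using aw p' wT in_arcsD1 by (auto simp: awalk_simps)
      moreover have "awalk_verts p (q @ [(p', w)]) = awalk_verts p q @ [w]"
        using aw calculation by (subst awalk_verts_append) auto
      ultimately have "cycle ?c" using sym[OF pw(3)] dq q(2) pw wT
        unfolding cycle_def by (intro exI[of _ w]) (auto simp: awalk_simps)
      moreover have "q \<noteq> []" using aw ne by (auto simp: awalk_Nil_iff)
      then have "3 \<le> length ?c" by (cases q) auto
      ultimately show False using acyc by force
    qed
    have "conn_in (insert w P)"
      unfolding conn_in_def
    proof (intro ballI)
      fix p1 p2 assume p12: "p1 \<in> insert w P" "p2 \<in> insert w P"
      consider "p1 = w" "p2 = w" | "p1 \<in> P" "p2 \<in> P" | "p1 = w" "p2 \<in> P" | "p1 \<in> P" "p2 = w"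
        using p12 by blast
      then show "\<exists>q. apath p1 q p2 \<and> set (awalk_verts p1 q) \<subseteq> insert w P"
      proof cases
        case 1 then show ?thesis using wT by (intro exI[of _ "[]"]) (auto simp: apath_Nil_iff)
      next
        case 2 then show ?thesis using xP(4) unfolding conn_in_def by blast
      next
        case 3
        then obtain q where q: "apath p q p2" "set (awalk_verts p q) \<subseteq> P"
          using xP(4) pw unfolding conn_in_def by blast
        show ?thesis using 3 q pw sym wT
          by (intro exI[of _ "(w, p) # q"]) (auto simp: apath_Cons_iff)
      next
        case 4
        then obtain q where q: "apath p1 q p" "set (awalk_verts p1 q) \<subseteq> P"
          using xP(4) pw unfolding conn_in_def by blast
        have aw: "awalk p1 q p" using q by (auto simp: apath_def)
        have aw2: "awalk p1 (q @ [(p, w)]) w"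
          using aw pw wT in_arcsD1 by (auto simp: awalk_simps)
        have "awalk_verts p1 (q @ [(p, w)]) = awalk_verts p1 q @ [w]"
          using aw aw2 by (subst awalk_verts_append) auto
        then show ?thesis using 4 q pw aw2
          by (intro exI[of _ "q @ [(p, w)]"]) (auto simp: apath_def)
      qed
    qed
    then have "good (insert w P)"
      using xP wT step[OF xP(1-3) pw(1) wT pw(2,3) uniq xP(5)] by (auto simp: good_def)
    then show ?thesis using pw by blast
  qed
  have xu: "x \<in> pverts T" "u \<in> pverts T" "x \<noteq> u"
    using arc in_arcsD1 in_arcsD2 pair_no_loops[OF arc] by auto
  have "\<exists>q. apath p1 q p2 \<and> set (awalk_verts p1 q) \<subseteq> {x, u}" if "p1 \<in> {x, u}" "p2 \<in> {x, u}" for p1 p2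
  proof (cases "p1 = p2")
    case True
    then show ?thesis using that xu by (intro exI[of _ "[]"]) (auto simp: apath_simps)
  next
    case False
    then show ?thesis using that xu arc sym[OF arc]
      by (intro exI[of _ "[(p1, p2)]"]) (auto simp: apath_simps)
  qed
  then have "good {x, u}" using base xu by (auto simp: good_def conn_in_def)
  then have "\<exists>P. good P \<and> (\<forall>P'. good P' \<longrightarrow> \<not> P \<subset> P')"
  proof -
    have "finite {P. good P}"
      by (rule finite_subset[of _ "Pow (pverts T)"]) (auto simp: good_def)
    then obtain P where "P \<in> {P. good P}" "\<forall>P'\<in>{P. good P}. P \<subseteq> P' \<longrightarrow> P = P'"
      using finite_has_maximal[of "{P. good P}"] \<open>good {x, u}\<close> by auto
    then show ?thesis by blast
  qed
  then obtain P where "good P" "\<forall>P'. good P' \<longrightarrow> \<not> P \<subset> P'" by blast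
  with extend have "P = pverts T" by blast
  then show ?thesis using \<open>good P\<close> by (simp add: good_def)
qed

lemma critical_leaf_unique_neighbour:
  assumes T: "undirected_tree T" and bip: "bipartition T U V" and x: "critical_leaf T V x"
  obtains u where "u \<in> U" "(x, u) \<in> parcs T" "\<And>w. (w, x) \<in> parcs T \<Longrightarrow> w = u"
proof -
  interpret pair_graph T using T by (simp add: undirected_tree_def)
  have "card (out_arcs (with_proj T) x) = 1"
    using x by (simp add: critical_leaf_def out_degree_def)
  then obtain e where e: "out_arcs (with_proj T) x = {e}" by (auto simp: card_1_singleton_iff)
  then have "e \<in> out_arcs (with_proj T) x" by auto
  then obtain u where eu: "e = (x, u)" "(x, u) \<in> parcs T" by (cases e) (auto simp: out_arcs_def)
  have "w = u" if "(w, x) \<in> parcs T" for w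
  proof -
    have "(x, w) \<in> parcs T" using that pair_sym_arcs by (auto simp: symmetric_def sym_def)
    then have "(x, w) \<in> out_arcs (with_proj T) x" by (auto simp: out_arcs_def)
    then show ?thesis using e eu by auto
  qed
  moreover have "u \<in> U" using eu bip x by (auto simp: bipartition_def critical_leaf_def)
  ultimately show thesis using that eu by blast
qed

text \<open>Only the sets that replace the vertices matter for a copy: arbitrary enumerations of
  these disjoint sets combine to one injection. Embeddings can thus be built with set
  values.\<close>

lemma contains_blowupI:
  assumes fin: "finite U" "finite V" and bip: "U \<inter> V = {}"
    and cardU: "\<And>u. u \<in> U \<Longrightarrow> card (\<phi> u) = a" and cardV: "\<And>v. v \<in> V \<Longrightarrow> card (\<phi> v) = b"
    and finphi: "\<And>w. w \<in> U \<union> V \<Longrightarrow> finite (\<phi> w)"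
    and sub: "\<And>w. w \<in> U \<union> V \<Longrightarrow> \<phi> w \<subseteq> W"
    and disj: "\<And>v w. v \<in> U \<union> V \<Longrightarrow> w \<in> U \<union> V \<Longrightarrow> v \<noteq> w \<Longrightarrow> \<phi> v \<inter> \<phi> w = {}"
    and edge: "\<And>u v. u \<in> U \<Longrightarrow> v \<in> V \<Longrightarrow> (u, v) \<in> parcs T \<Longrightarrow> \<phi> u \<union> \<phi> v \<in> H"
  shows "\<not> blowup_free a b T U V W H"
proof -
  have "\<exists>h. bij_betw h {..<card (\<phi> w)} (\<phi> w)" if "w \<in> U \<union> V" for w
    using ex_bij_betw_nat_finite[OF finphi[OF that]] by (simp add: lessThan_atLeast0)
  then obtain h where h: "\<And>w. w \<in> U \<union> V \<Longrightarrow> bij_betw (h w) {..<card (\<phi> w)} (\<phi> w)" by metis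
  define f where "f = (\<lambda>(w, k). h w k)"
  have imgU: "f ` ({u} \<times> {..<a}) = \<phi> u" if "u \<in> U" for u
  proof -
    have "f ` ({u} \<times> {..<a}) = h u ` {..<a}" by (force simp: f_def)
    then show ?thesis using h[of u] cardU[of u] that by (simp add: bij_betw_def)
  qed
  have imgV: "f ` ({v} \<times> {..<b}) = \<phi> v" if "v \<in> V" for v
  proof -
    have "f ` ({v} \<times> {..<b}) = h v ` {..<b}" by (force simp: f_def)
    then show ?thesis using h[of v] cardV[of v] that by (simp add: bij_betw_def)
  qed
  have mem: "w \<in> U \<union> V \<and> k < card (\<phi> w)" if "(w, k) \<in> blowup_verts a b U V" for w k
    using that cardU cardV by (auto simp: blowup_verts_def)
  have mem2: "h w k \<in> \<phi> w" if "(w, k) \<in> blowup_verts a b U V" for w k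
    using mem[OF that] h by (auto simp: bij_betw_def)
  have "inj_on f (blowup_verts a b U V)"
  proof (rule inj_onI, clarify)
    fix w k w' k'
    assume A: "(w, k) \<in> blowup_verts a b U V" "(w', k') \<in> blowup_verts a b U V" "f (w, k) = f (w', k')"
    then have eq: "h w k = h w' k'" by (simp add: f_def)
    have "w = w'" using mem2[OF A(1)] mem2[OF A(2)] eq mem[OF A(1)] mem[OF A(2)] disj[of w w'] by auto
    moreover have "k = k'" using h[of w] mem[OF A(1)] mem[OF A(2)] eq \<open>w = w'\<close>
      by (auto simp: bij_betw_def inj_on_def)
    ultimately show "w = w' \<and> k = k'" by simp
  qed
  moreover have "f ` blowup_verts a b U V \<subseteq> W"
    using mem2 mem sub by (fastforce simp: f_def)
  moreover have "\<forall>e\<in>blowup_edges a b T U V. f ` e \<in> H"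
    using imgU imgV edge by (auto simp: blowup_edges_def image_Un)
  ultimately show ?thesis unfolding blowup_free_def contains_copy_def by blast
qed

text \<open>
  The tree is embedded greedily.  A member \<open>g\<close> of \<open>F\<close> (a frame) offers the place \<open>Aset g\<close> to vertices
  of \<open>U\<close> and the place \<open>Bset v g\<close> to the vertex \<open>v \<in> V\<close>; consecutive vertices of the tree are placed
  in frames that share a place.  The set \<open>P v\<close> is reserved for \<open>v\<close>, so that \<open>Bset v g\<close> need not be
  fresh there.  The leaf \<open>x\<close> is embedded first, at \<open>Z\<close>, and needs no frame.
\<close>

lemma blowup_embedding:
  fixes Aset :: "'f \<Rightarrow> 'w set" and Bset :: "'v \<Rightarrow> 'f \<Rightarrow> 'w set" and P :: "'v \<Rightarrow> 'w set"
  assumes T: "undirected_tree T" and bip: "bipartition T U V" and x: "critical_leaf T V x"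
    and H: "\<And>e. e \<in> H \<Longrightarrow> e \<subseteq> W" and finW: "finite W"
    and A: "\<And>g. g \<in> F \<Longrightarrow> Aset g \<subseteq> W \<and> card (Aset g) = a"
    and B: "\<And>g v. g \<in> F \<Longrightarrow> v \<in> V - {x} \<Longrightarrow>
         card (Bset v g) = b \<and> Aset g \<inter> Bset v g = {} \<and> Aset g \<union> Bset v g \<in> H"
    and PA: "\<And>g v. g \<in> F \<Longrightarrow> v \<in> V - {x} \<Longrightarrow> Aset g \<inter> P v = {}"
    and PB: "\<And>g v v'. g \<in> F \<Longrightarrow> v \<in> V - {x} \<Longrightarrow> v' \<in> V - {x} \<Longrightarrow> v \<noteq> v' \<Longrightarrow> Bset v g \<inter> P v' = {}"
    and g0: "g0 \<in> F" and Z: "card Z = b" "Aset g0 \<inter> Z = {}" "Aset g0 \<union> Z \<in> H"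
    and PZ: "\<And>v. v \<in> V - {x} \<Longrightarrow> Z \<inter> P v = {}"
    and ext1: "\<And>g v X. g \<in> F \<Longrightarrow> v \<in> V - {x} \<Longrightarrow> X \<subseteq> W \<Longrightarrow> card X \<le> card U * a + card V * b \<Longrightarrow>
         \<exists>h\<in>F. Aset h = Aset g \<and> Bset v h \<inter> X \<subseteq> P v"
    and ext2: "\<And>g v X. g \<in> F \<Longrightarrow> v \<in> V - {x} \<Longrightarrow> X \<subseteq> W \<Longrightarrow> card X \<le> card U * a + card V * b \<Longrightarrow>
         \<exists>h\<in>F. Bset v h = Bset v g \<and> Aset h \<inter> X = {}"
  shows "\<not> blowup_free a b T U V W H"
proof -
  interpret pair_graph T using T by (simp add: undirected_tree_def)
  have UV: "U \<union> V = pverts T" "U \<inter> V = {}" 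
    and arcs: "\<And>v w. (v, w) \<in> parcs T \<Longrightarrow> (v \<in> U \<and> w \<in> V) \<or> (v \<in> V \<and> w \<in> U)"
    using bip by (auto simp: bipartition_def)
  have fin: "finite U" "finite V" using UV pair_finite_verts by (metis finite_Un)+
  have sym: "(v, w) \<in> parcs T" if "(w, v) \<in> parcs T" for v w
    using that pair_sym_arcs by (auto simp: symmetric_def sym_def)
  have xV: "x \<in> V" using x by (simp add: critical_leaf_def)
  obtain u where u: "u \<in> U" "(x, u) \<in> parcs T" "\<And>w. (w, x) \<in> parcs T \<Longrightarrow> w = u"
    using critical_leaf_unique_neighbour[OF T bip x] by metis
  have ZW: "Z \<subseteq> W" using H[OF Z(3)] by auto
  have BW: "Bset v g \<subseteq> W" if "g \<in> F" "v \<in> V - {x}" for g v using H B[OF that] by auto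
  \<comment> \<open>Besides the sets \<open>\<phi> w\<close> the invariant keeps the frame
    \<open>fr w\<close> of each vertex other than \<open>x\<close>, since a new neighbour is placed
    by modifying that frame.\<close>
  define Q where "Q S \<longleftrightarrow> (\<exists>\<phi> fr. \<phi> x = Z \<and>
      (\<forall>w\<in>S \<inter> U. fr w \<in> F \<and> \<phi> w = Aset (fr w)) \<and>
      (\<forall>w\<in>S \<inter> (V - {x}). fr w \<in> F \<and> \<phi> w = Bset w (fr w)) \<and>
      (\<forall>v\<in>S. \<forall>w\<in>S. v \<noteq> w \<longrightarrow> \<phi> v \<inter> \<phi> w = {}) \<and>
      (\<forall>v\<in>S \<inter> U. \<forall>w\<in>S \<inter> V. (v, w) \<in> parcs T \<longrightarrow> \<phi> v \<union> \<phi> w \<in> H))" for S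
  have "Q (pverts T)"
  proof (rule tree_growth_induct[OF T u(2)])
    have "x \<noteq> u" using u UV xV by auto
    then show "Q {x, u}" unfolding Q_def using u UV xV Z g0
      by (intro exI[of _ "\<lambda>w. if w = x then Z else Aset g0"] exI[of _ "\<lambda>_. g0"]) auto
  next
    fix S p w
    assume S: "x \<in> S" "u \<in> S" "S \<subseteq> pverts T" "p \<in> S" "w \<in> pverts T" "w \<notin> S" "(p, w) \<in> parcs T"
      and un: "\<And>p'. p' \<in> S \<Longrightarrow> (p', w) \<in> parcs T \<Longrightarrow> p' = p" and "Q S"
    from \<open>Q S\<close> obtain \<phi> fr where phix: "\<phi> x = Z"
      and phiU: "\<forall>w\<in>S \<inter> U. fr w \<in> F \<and> \<phi> w = Aset (fr w)"
      and phiV: "\<forall>w\<in>S \<inter> (V - {x}). fr w \<in> F \<and> \<phi> w = Bset w (fr w)"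
      and dis: "\<forall>v\<in>S. \<forall>w\<in>S. v \<noteq> w \<longrightarrow> \<phi> v \<inter> \<phi> w = {}"
      and edg: "\<forall>v\<in>S \<inter> U. \<forall>w\<in>S \<inter> V. (v, w) \<in> parcs T \<longrightarrow> \<phi> v \<union> \<phi> w \<in> H"
      unfolding Q_def by blast
    \<comment> \<open>The only neighbour of \<open>x\<close> is \<open>u\<close>, which is present
      from the start, so the tree never grows at \<open>x\<close>.\<close>
    have px: "p \<noteq> x"
    proof
      assume "p = x"
      then have "w = u" using u(3) sym S(7) by blast
      then show False using S by blast
    qed
    have SUV: "S \<subseteq> U \<union> V" using S(3) UV(1) by simp
    define X where "X = (\<Union>v\<in>S. \<phi> v)"
    have cardphi: "card (\<phi> v) = (if v \<in> U then a else b)" if vS: "v \<in> S" for v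
    proof -
      consider "v = x" | "v \<in> S \<inter> U" | "v \<in> S \<inter> (V - {x})" using SUV vS by blast
      then show ?thesis
      proof cases
        case 1 then show ?thesis using phix Z(1) xV UV by auto
      next
        case 2 then show ?thesis using phiU A by simp
      next
        case 3
        then have "v \<notin> U" using UV by blast
        then show ?thesis using 3 phiV B by simp
      qed
    qed
    have XW: "X \<subseteq> W" unfolding X_def
    proof (rule UN_least)
      fix v assume "v \<in> S"
      then consider "v = x" | "v \<in> S \<inter> U" | "v \<in> S \<inter> (V - {x})" using SUV by blast
      then show "\<phi> v \<subseteq> W"
        by cases (use phix ZW phiU A phiV BW in \<open>simp_all\<close>)
    qed
    have "card X \<le> (\<Sum>v\<in>S. card (\<phi> v))" unfolding X_def
      by (rule card_UN_le) (rule finite_subset[OF S(3) pair_finite_verts])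
    also have "\<dots> = (\<Sum>v\<in>S. if v \<in> U then a else b)" using cardphi by (intro sum.cong) auto
    also have "\<dots> \<le> (\<Sum>v\<in>U \<union> V. if v \<in> U then a else b)"
      by (rule sum_mono2) (use S(3) UV fin in auto)
    also have "\<dots> = card U * a + card V * b"
    proof -
      have "(\<Sum>v\<in>U. if v \<in> U then a else b) = (\<Sum>v\<in>U. a)" by (rule sum.cong) auto
      moreover have "(\<Sum>v\<in>V. if v \<in> U then a else b) = (\<Sum>v\<in>V. b)"
        using UV(2) by (intro sum.cong) auto
      ultimately show ?thesis
        by (simp add: sum.union_disjoint[OF fin UV(2)] del: sum.If_cases)
    qed
    finally have Xc: "card X \<le> card U * a + card V * b" .
    show "Q (insert w S)"
    proof (cases "w \<in> V")
      case True
      then have pU: "p \<in> U" using arcs[OF S(7)] UV by auto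
      have wV: "w \<in> V - {x}" using True S by auto
      \<comment> \<open>Everything embedded so far avoids the set reserved for \<open>w\<close>, so
        the inclusion in \<open>P w\<close> granted by \<open>ext1\<close> amounts to disjointness
        from \<open>X\<close>.\<close>
      have XP: "X \<inter> P w = {}"
      proof -
        have "\<phi> v \<inter> P w = {}" if vS: "v \<in> S" for v
        proof -
          consider "v = x" | "v \<in> S \<inter> U" | "v \<in> S \<inter> (V - {x})" using SUV vS by blast
          then show ?thesis
          proof cases
            case 1 then show ?thesis using phix PZ[OF wV] by simp
          next
            case 2 then show ?thesis using phiU PA[OF _ wV] by simp
          next
            case 3 then show ?thesis using phiV PB[OF _ _ wV] S(6) by (metis IntE)
          qed
        qed
        then show ?thesis by (auto simp: X_def)
      qed
      obtain h where h: "h \<in> F" "Aset h = Aset (fr p)" "Bset w h \<inter> X \<subseteq> P w"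
        using ext1[OF _ wV XW Xc, of "fr p"] phiU pU S(4) by auto
      have hX: "Bset w h \<inter> X = {}" using h XP by blast
      have ed: "\<phi> p \<union> Bset w h \<in> H" using B[OF h(1) wV] h(2) phiU pU S(4) by auto
      show ?thesis unfolding Q_def
      proof (intro exI conjI)
        show "(\<phi>(w := Bset w h)) x = Z" using phix S by auto
        show "\<forall>v\<in>insert w S \<inter> U. (fr(w := h)) v \<in> F \<and> (\<phi>(w := Bset w h)) v = Aset ((fr(w := h)) v)"
          using phiU True UV by auto
        show "\<forall>v\<in>insert w S \<inter> (V - {x}). (fr(w := h)) v \<in> F \<and> (\<phi>(w := Bset w h)) v = Bset v ((fr(w := h)) v)"
          using phiV h by auto
        show "\<forall>v\<in>insert w S. \<forall>w'\<in>insert w S. v \<noteq> w' \<longrightarrow> (\<phi>(w := Bset w h)) v \<inter> (\<phi>(w := Bset w h)) w' = {}"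
          using dis hX by (auto simp: X_def)
        show "\<forall>v\<in>insert w S \<inter> U. \<forall>w'\<in>insert w S \<inter> V. (v, w') \<in> parcs T \<longrightarrow>
            (\<phi>(w := Bset w h)) v \<union> (\<phi>(w := Bset w h)) w' \<in> H"
          using edg ed un UV True S(6) by auto
      qed
    next
      case False
      then have wU: "w \<in> U" using S(5) UV by auto
      have pV: "p \<in> V - {x}" using arcs[OF S(7)] UV px False by auto
      obtain h where h: "h \<in> F" "Bset p h = Bset p (fr p)" "Aset h \<inter> X = {}"
        using ext2[OF _ pV XW Xc, of "fr p"] phiV pV S(4) by auto
      have ed: "Aset h \<union> \<phi> p \<in> H" using B[OF h(1) pV] h(2) phiV pV S(4) by auto
      show ?thesis unfolding Q_def
      proof (intro exI conjI)
        show "(\<phi>(w := Aset h)) x = Z" using phix S by auto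
        show "\<forall>v\<in>insert w S \<inter> U. (fr(w := h)) v \<in> F \<and> (\<phi>(w := Aset h)) v = Aset ((fr(w := h)) v)"
          using phiU h by auto
        show "\<forall>v\<in>insert w S \<inter> (V - {x}). (fr(w := h)) v \<in> F \<and> (\<phi>(w := Aset h)) v = Bset v ((fr(w := h)) v)"
          using phiV False by auto
        show "\<forall>v\<in>insert w S. \<forall>w'\<in>insert w S. v \<noteq> w' \<longrightarrow> (\<phi>(w := Aset h)) v \<inter> (\<phi>(w := Aset h)) w' = {}"
          using dis h by (auto simp: X_def)
        show "\<forall>v\<in>insert w S \<inter> U. \<forall>w'\<in>insert w S \<inter> V. (v, w') \<in> parcs T \<longrightarrow>
            (\<phi>(w := Aset h)) v \<union> (\<phi>(w := Aset h)) w' \<in> H"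
          using edg ed un sym UV False S(6) by auto
      qed
    qed
  qed
  then obtain \<phi> fr where phix: "\<phi> x = Z"
    and phiU': "\<forall>w\<in>pverts T \<inter> U. fr w \<in> F \<and> \<phi> w = Aset (fr w)"
    and phiV': "\<forall>w\<in>pverts T \<inter> (V - {x}). fr w \<in> F \<and> \<phi> w = Bset w (fr w)"
    and dis': "\<forall>v\<in>pverts T. \<forall>w\<in>pverts T. v \<noteq> w \<longrightarrow> \<phi> v \<inter> \<phi> w = {}"
    and edg': "\<forall>v\<in>pverts T \<inter> U. \<forall>w\<in>pverts T \<inter> V. (v, w) \<in> parcs T \<longrightarrow> \<phi> v \<union> \<phi> w \<in> H"
    unfolding Q_def by blast
  have phiU: "fr w \<in> F \<and> \<phi> w = Aset (fr w)" if "w \<in> U" for w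
    using that phiU' UV by blast
  have phiV: "fr w \<in> F \<and> \<phi> w = Bset w (fr w)" if "w \<in> V - {x}" for w
    using that phiV' UV by blast
  have dis: "\<phi> v \<inter> \<phi> w = {}" if "v \<in> U \<union> V" "w \<in> U \<union> V" "v \<noteq> w" for v w
    using that dis' UV(1)[symmetric] by simp
  have edg: "\<phi> v \<union> \<phi> w \<in> H" if "v \<in> U" "w \<in> V" "(v, w) \<in> parcs T" for v w
    using that edg' UV(1)[symmetric] by simp
  have sub: "\<phi> w \<subseteq> W" if wUV: "w \<in> U \<union> V" for w
  proof -
    consider "w = x" | "w \<in> U" | "w \<in> V - {x}" using wUV by blast
    then show ?thesis by cases (use phix ZW phiU A phiV BW in \<open>simp_all\<close>)
  qed
  show ?thesis
  proof (rule contains_blowupI[OF fin UV(2), of \<phi>])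
    show "card (\<phi> v) = b" if "v \<in> V" for v
      using that phiV phix Z(1) B by (cases "v = x") simp_all
    show "finite (\<phi> w)" if "w \<in> U \<union> V" for w
      using sub[OF that] finW finite_subset by blast
    show "card (\<phi> u) = a" if "u \<in> U" for u using phiU[OF that] A by simp
  qed (fact sub dis edg)+
qed

section \<open>Homogeneous families of functions\<close>

definition agree :: "'i set \<Rightarrow> ('i \<Rightarrow> 'w) \<Rightarrow> ('i \<Rightarrow> 'w) \<Rightarrow> 'i set" where
  "agree I g h = {i \<in> I. g i = h i}"

text \<open>Takes the place of a large sunflower with the restriction of \<open>g\<close> to
  \<open>K\<close> as its kernel: outside \<open>K\<close> any \<open>q\<close> given values can be
  avoided.\<close>

definition rich :: "nat \<Rightarrow> 'i set \<Rightarrow> ('i \<Rightarrow> 'w) set \<Rightarrow> 'i set \<Rightarrow> ('i \<Rightarrow> 'w) \<Rightarrow> bool" where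
  "rich q I F K g \<longleftrightarrow> (\<forall>X. finite X \<longrightarrow> card X \<le> q \<longrightarrow>
     (\<exists>h\<in>F. (\<forall>i\<in>K. h i = g i) \<and> (\<forall>i\<in>I - K. h i \<notin> X)))"

lemma richE:
  assumes "rich q I F K g" "finite X" "card X \<le> q"
  obtains h where "h \<in> F" "\<And>i. i \<in> K \<Longrightarrow> h i = g i" "\<And>i. i \<in> I - K \<Longrightarrow> h i \<notin> X"
proof -
  have "\<exists>h\<in>F. (\<forall>i\<in>K. h i = g i) \<and> (\<forall>i\<in>I - K. h i \<notin> X)"
    using assms by (simp add: rich_def)
  then show thesis using that by auto
qed

lemma pigeonhole_cover:
  assumes "finite A" "A \<noteq> {}" "Q \<subseteq> (\<Union>p\<in>A. B p)" "\<And>p. p \<in> A \<Longrightarrow> finite (B p)"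
  obtains p where "p \<in> A" "card Q \<le> card A * card (B p)"
proof -
  have "Max ((\<lambda>p. card (B p)) ` A) \<in> (\<lambda>p. card (B p)) ` A" using assms(1,2) by simp
  then obtain p where p: "p \<in> A" "Max ((\<lambda>p. card (B p)) ` A) = card (B p)" by blast
  have le: "card (B p') \<le> card (B p)" if "p' \<in> A" for p'
    using p(2) that assms(1) by (metis Max_ge finite_imageI imageI)
  have "card Q \<le> card (\<Union>p\<in>A. B p)" by (rule card_mono) (use assms in auto)
  also have "\<dots> \<le> (\<Sum>p\<in>A. card (B p))" by (rule card_UN_le) (rule assms)
  also have "\<dots> \<le> of_nat (card A) * card (B p)" by (rule sum_bounded_above) (rule le)
  finally show thesis using that p(1) by simp
qed

text \<open>
  As long as some \<open>K\<close> is not rich at some \<open>g\<close>, the members agreeing with \<open>g\<close> on \<open>K\<close> are removed; a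
  bounded fraction of them shares one more value, and these are collected in \<open>D K\<close>.
\<close>

lemma peel_poor:
  assumes "finite F" "finite I" "finite L"
  shows "\<exists>F' D. F' \<subseteq> F \<and> (\<forall>K\<in>L. \<forall>g\<in>F'. rich q I F' K g) \<and>
     (\<forall>K\<in>L. D K \<subseteq> F \<and> (\<forall>g\<in>D K. \<forall>h\<in>D K. agree I g h \<noteq> K)) \<and>
     card F \<le> card F' + card I * q * (\<Sum>K\<in>L. card (D K))"
  using assms(1)
proof (induction "card F" arbitrary: F rule: less_induct)
  case less
  show ?case
  proof (cases "\<forall>K\<in>L. \<forall>g\<in>F. rich q I F K g")
    case True
    then show ?thesis by (intro exI[of _ F] exI[of _ "\<lambda>_. {}"]) auto
  next
    case False
    then obtain K0 g where K0: "K0 \<in> L" "g \<in> F" "\<not> rich q I F K0 g" by blast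
    then obtain X where X: "finite X" "card X \<le> q"
      "\<not> (\<exists>h\<in>F. (\<forall>i\<in>K0. h i = g i) \<and> (\<forall>i\<in>I - K0. h i \<notin> X))"
      by (auto simp: rich_def)
    define Q where "Q = {h \<in> F. \<forall>i\<in>K0. h i = g i}"
    have gQ: "g \<in> Q" and QF: "Q \<subseteq> F" using K0 by (auto simp: Q_def)
    have finQ: "finite Q" using QF less.prems finite_subset by blast
    have cov: "Q \<subseteq> (\<Union>p\<in>(I - K0) \<times> X. {h \<in> Q. h (fst p) = snd p})"
    proof
      fix h assume h: "h \<in> Q"
      then have "\<not> (\<forall>i\<in>I - K0. h i \<notin> X)" using X(3) unfolding Q_def by blast
      then show "h \<in> (\<Union>p\<in>(I - K0) \<times> X. {h \<in> Q. h (fst p) = snd p})" using h by auto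
    qed
    obtain p where p: "p \<in> (I - K0) \<times> X"
      "card Q \<le> card ((I - K0) \<times> X) * card {h \<in> Q. h (fst p) = snd p}"
    proof (rule pigeonhole_cover[OF _ _ cov])
      show "(I - K0) \<times> X \<noteq> {}" using cov gQ by blast
    qed (use assms X(1) finQ in simp_all)
    define i y where "i = fst p" and "y = snd p"
    have iy: "i \<in> I" "i \<notin> K0" "y \<in> X" "card Q \<le> card ((I - K0) \<times> X) * card {h \<in> Q. h i = y}"
      using p by (auto simp: i_def y_def mem_Times_iff)
    \<comment> \<open>Members of \<open>Q'\<close> share the value \<open>y\<close> at
      \<open>i\<close>, which is outside \<open>K0\<close>, in addition to their values on
      \<open>K0\<close>, so no two of them agree exactly on \<open>K0\<close>. With members of
      \<open>F - Q\<close> they do not even agree on all of \<open>K0\<close>.\<close>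
    define Q' where "Q' = {h \<in> Q. h i = y}"
    have "card ((I - K0) \<times> X) \<le> card I * q"
      using X(2) assms(2) by (simp add: card_cartesian_product mult_le_mono card_mono)
    then have cQ: "card Q \<le> card I * q * card Q'"
      using iy(4) mult_le_mono1 order_trans unfolding Q'_def by blast
    have lt: "card (F - Q) < card F"
      using gQ QF less.prems by (intro psubset_card_mono) auto
    obtain F' D where FD: "F' \<subseteq> F - Q" "\<forall>K\<in>L. \<forall>g\<in>F'. rich q I F' K g"
      "\<forall>K\<in>L. D K \<subseteq> F - Q \<and> (\<forall>g\<in>D K. \<forall>h\<in>D K. agree I g h \<noteq> K)"
      "card (F - Q) \<le> card F' + card I * q * (\<Sum>K\<in>L. card (D K))"
      using less.hyps[OF lt] less.prems by blast
    define D' where "D' = D(K0 := D K0 \<union> Q')"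
    have 1: "agree I h h' \<noteq> K0" if "h \<in> F - Q" "h' \<in> Q'" for h h'
    proof
      assume "agree I h h' = K0"
      then have "\<forall>i\<in>K0. h i = h' i" by (auto simp: agree_def)
      then show False using that by (auto simp: Q_def Q'_def)
    qed
    have 2: "agree I h h' \<noteq> K0" if "h \<in> Q'" "h' \<in> Q'" for h h'
      using that iy by (auto simp: agree_def Q'_def)
    have sym: "agree I h h' = agree I h' h" for h h' :: "'a \<Rightarrow> 'b" by (auto simp: agree_def)
    have D': "\<forall>K\<in>L. D' K \<subseteq> F \<and> (\<forall>g\<in>D' K. \<forall>h\<in>D' K. agree I g h \<noteq> K)"
    proof
      fix K assume K: "K \<in> L"
      show "D' K \<subseteq> F \<and> (\<forall>g\<in>D' K. \<forall>h\<in>D' K. agree I g h \<noteq> K)"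
      proof (cases "K = K0")
        case False
        then show ?thesis using FD(3) K by (auto simp: D'_def)
      next
        case True
        have "D' K \<subseteq> F" using FD(3) K0(1) QF True by (auto simp: D'_def Q'_def)
        moreover have "agree I h h' \<noteq> K0" if hh: "h \<in> D K0 \<union> Q'" "h' \<in> D K0 \<union> Q'" for h h'
        proof -
          have DK: "h \<in> F - Q" if "h \<in> D K0" for h using FD(3) K0(1) that by blast
          consider "h \<in> D K0" "h' \<in> D K0" | "h \<in> D K0" "h' \<in> Q'" | "h \<in> Q'" "h' \<in> D K0" | "h \<in> Q'" "h' \<in> Q'"
            using hh by blast
          then show ?thesis
          proof cases
            case 1 then show ?thesis using FD(3) K0(1) by blast
          next
            case 2 then show ?thesis using 1[OF DK] by blast
          next
            case 3 then show ?thesis using 1[OF DK, of h' h] sym[of h h'] by simp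
          next
            case 4 then show ?thesis using 2 by blast
          qed
        qed
        ultimately show ?thesis using True by (simp add: D'_def)
      qed
    qed
    have "card (D K0 \<union> Q') = card (D K0) + card Q'"
    proof (rule card_Un_disjoint)
      have "D K0 \<subseteq> F - Q" using FD(3) K0(1) by blast
      then show "finite (D K0)" "D K0 \<inter> Q' = {}"
        using less.prems finite_subset[of "D K0" F] by (auto simp: Q'_def)
      show "finite Q'" using finQ by (simp add: Q'_def)
    qed
    then have sumD: "(\<Sum>K\<in>L. card (D' K)) = (\<Sum>K\<in>L. card (D K)) + card Q'"
      using K0(1) assms(3) by (simp add: D'_def sum.remove[of L K0])
    have "card F = card (F - Q) + card Q"
      using card_Diff_subset[OF finQ QF] card_mono[OF less.prems QF] by simp
    also have "\<dots> \<le> card F' + card I * q * (\<Sum>K\<in>L. card (D' K))"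
      using FD(4) cQ sumD by (simp add: algebra_simps)
    finally show ?thesis using FD D' by blast
  qed
qed

text \<open>Induction on the number of agreement sets not yet excluded. Peeling either keeps half of
  \<open>F\<close>, and then \<open>L\<close> itself serves as \<open>J\<close>, or some
  \<open>D K\<close> is large; inside it \<open>K\<close> no longer occurs as an agreement set and
  is dropped from \<open>L\<close>. Each such round costs the factor
  \<open>2 * (card I * q) * 2 ^ card I\<close>, the last one a factor 2.\<close>

lemma homogeneous_subfamily_aux:
  assumes "finite F" "finite I" "I \<noteq> {}" "q > 0" "L \<subseteq> Pow I"
    and "\<forall>K\<in>Pow I - L. \<forall>g\<in>F. \<forall>h\<in>F. agree I g h \<noteq> K"
  shows "\<exists>F' J. F' \<subseteq> F \<and> J \<subseteq> L \<and> card F \<le> 2 * (2 * (card I * q) * 2 ^ card I) ^ card L * card F' \<and>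
     (\<forall>K\<in>J. \<forall>g\<in>F'. rich q I F' K g) \<and> (\<forall>K\<in>Pow I - J. \<forall>g\<in>F'. \<forall>h\<in>F'. agree I g h \<noteq> K)"
  using assms
proof (induction "card L" arbitrary: F L)
  case hyp: 0
  then have finL: "finite L" by (meson finite_Pow_iff finite_subset)
  then have "L = {}" using hyp by simp
  then show ?case using hyp by (intro exI[of _ F] exI[of _ "{}"]) auto
next
  case (Suc n)
  let ?c = "2 * (card I * q) * 2 ^ card I"
  have cpos: "1 \<le> ?c" using Suc.prems by (simp add: card_gt_0_iff Suc_leI)
  have finL: "finite L" using Suc.prems by (meson finite_Pow_iff finite_subset)
  obtain F' D where FD: "F' \<subseteq> F" "\<forall>K\<in>L. \<forall>g\<in>F'. rich q I F' K g"
     "\<forall>K\<in>L. D K \<subseteq> F \<and> (\<forall>g\<in>D K. \<forall>h\<in>D K. agree I g h \<noteq> K)"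
     "card F \<le> card F' + card I * q * (\<Sum>K\<in>L. card (D K))"
    using peel_poor[OF Suc.prems(1,2) finL, of q] by blast
  show ?case
  proof (cases "card F \<le> 2 * card F'")
    case True
    have "1 \<le> ?c ^ card L" using cpos by (rule one_le_power)
    then have "2 * card F' \<le> 2 * ?c ^ card L * card F'" by simp
    then have "card F \<le> 2 * ?c ^ card L * card F'" using True by (rule order_trans[rotated])
    moreover have "\<forall>K\<in>Pow I - L. \<forall>g\<in>F'. \<forall>h\<in>F'. agree I g h \<noteq> K"
      using FD(1) Suc.prems(6) by (meson subsetD)
    ultimately have "F' \<subseteq> F \<and> L \<subseteq> L \<and> card F \<le> 2 * ?c ^ card L * card F' \<and>
      (\<forall>K\<in>L. \<forall>g\<in>F'. rich q I F' K g) \<and> (\<forall>K\<in>Pow I - L. \<forall>g\<in>F'. \<forall>h\<in>F'. agree I g h \<noteq> K)"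
      using FD(1,2) by (intro conjI subset_refl)
    then show ?thesis by (intro exI)
  next
    case False
    have Lne: "L \<noteq> {}" using Suc.hyps(2) by auto
    have "Max ((\<lambda>K. card (D K)) ` L) \<in> (\<lambda>K. card (D K)) ` L" using finL Lne by simp
    then obtain K where K: "K \<in> L" "Max ((\<lambda>K. card (D K)) ` L) = card (D K)" by auto
    have le: "card (D K') \<le> card (D K)" if "K' \<in> L" for K'
      using K(2) that finL by (metis Max_ge finite_imageI imageI)
    have "(\<Sum>K\<in>L. card (D K)) \<le> of_nat (card L) * card (D K)"
      by (rule sum_bounded_above) (rule le)
    also have "\<dots> \<le> 2 ^ card I * card (D K)"
      using card_mono[OF _ Suc.prems(5)] Suc.prems(2) by (simp add: card_Pow)
    finally have "card I * q * (\<Sum>K\<in>L. card (D K)) \<le> card I * q * (2 ^ card I * card (D K))"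
      by (rule mult_le_mono2)
    moreover have "card F \<le> 2 * (card I * q * (\<Sum>K\<in>L. card (D K)))" using FD(4) False by linarith
    ultimately have "card F \<le> 2 * (card I * q * (2 ^ card I * card (D K)))" by linarith
    then have cF: "card F \<le> ?c * card (D K)" by (simp only: mult.assoc)
    have DKF: "D K \<subseteq> F" using FD(3) K(1) by blast
    have n: "n = card (L - {K})" using Suc.hyps(2) K(1) finL by simp
    have fin: "finite (D K)" using DKF Suc.prems(1) finite_subset by blast
    have ag: "\<forall>K'\<in>Pow I - (L - {K}). \<forall>g\<in>D K. \<forall>h\<in>D K. agree I g h \<noteq> K'"
      using FD(3) K(1) Suc.prems(6) DKF by blast
    have LK: "L - {K} \<subseteq> Pow I" using Suc.prems(5) by blast
    obtain F'' J where J: "F'' \<subseteq> D K" "J \<subseteq> L - {K}" "card (D K) \<le> 2 * ?c ^ card (L - {K}) * card F''"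
     "\<forall>K\<in>J. \<forall>g\<in>F''. rich q I F'' K g" "\<forall>K\<in>Pow I - J. \<forall>g\<in>F''. \<forall>h\<in>F''. agree I g h \<noteq> K"
      using Suc.hyps(1)[OF n fin Suc.prems(2-4) LK ag] by blast
    have "card F \<le> ?c * (2 * ?c ^ n * card F'')"
      using cF J(3) n by (meson mult_le_mono2 order_trans)
    also have "\<dots> = 2 * ?c ^ card L * card F''" using Suc.hyps(2)[symmetric] by (simp add: mult_ac)
    finally show ?thesis using J DKF by (intro exI[of _ F''] exI[of _ J]) auto
  qed
qed

text \<open>
  The intersection semilattice lemma of Fueredi, with agreement of functions in place of
  intersection of the edges of a partite hypergraph.
\<close>

lemma homogeneous_subfamily:
  assumes "finite F" "finite I" "I \<noteq> {}" "q > 0"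
  obtains F' J where "F' \<subseteq> F" "J \<subseteq> Pow I"
    "card F \<le> 2 * (2 * (card I * q) * 2 ^ card I) ^ (2 ^ card I) * card F'"
    "\<And>K g. K \<in> J \<Longrightarrow> g \<in> F' \<Longrightarrow> rich q I F' K g"
    "\<And>g h. g \<in> F' \<Longrightarrow> h \<in> F' \<Longrightarrow> agree I g h \<in> J"
proof -
  obtain F' J where FJ: "F' \<subseteq> F" "J \<subseteq> Pow I"
    "card F \<le> 2 * (2 * (card I * q) * 2 ^ card I) ^ card (Pow I) * card F'"
    "\<forall>K\<in>J. \<forall>g\<in>F'. rich q I F' K g" "\<forall>K\<in>Pow I - J. \<forall>g\<in>F'. \<forall>h\<in>F'. agree I g h \<noteq> K"
    using homogeneous_subfamily_aux[OF assms, of "Pow I"] by auto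
  have "agree I g h \<in> J" if "g \<in> F'" "h \<in> F'" for g h
  proof -
    have "agree I g h \<in> Pow I" by (auto simp: agree_def)
    then show ?thesis using FJ(5) that by blast
  qed
  then show thesis using that[of F' J] FJ assms(2) by (simp add: card_Pow)
qed

text \<open>Take \<open>h1\<close> equal to \<open>g\<close> on \<open>K1\<close> and otherwise off
  the values of \<open>g\<close>, and \<open>h2\<close> equal to \<open>g\<close> on
  \<open>K2\<close> and otherwise off the values of both \<open>g\<close> and \<open>h1\<close>.
  They agree exactly on \<open>K1 \<inter> K2\<close>. Avoiding two members at once is the reason
  for \<open>2 * card I \<le> q\<close>.\<close>

lemma homogeneous_Int_closed:
  assumes "finite I" "J \<subseteq> Pow I" "2 * card I \<le> q" "F \<noteq> {}"
    and rich: "\<And>K g. K \<in> J \<Longrightarrow> g \<in> F \<Longrightarrow> rich q I F K g"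
    and agree: "\<And>g h. g \<in> F \<Longrightarrow> h \<in> F \<Longrightarrow> agree I g h \<in> J"
    and K: "K1 \<in> J" "K2 \<in> J"
  shows "K1 \<inter> K2 \<in> J"
proof -
  obtain g where g: "g \<in> F" using assms by blast
  have c: "card (g ` I) \<le> card I" for g :: "'a \<Rightarrow> 'b" using assms(1) card_image_le by blast
  obtain h1 where h1: "h1 \<in> F" "\<And>i. i \<in> K1 \<Longrightarrow> h1 i = g i" "\<And>i. i \<in> I - K1 \<Longrightarrow> h1 i \<notin> g ` I"
    using richE[OF rich[OF K(1) g], of "g ` I"] assms c[of g] by auto
  have "card (g ` I \<union> h1 ` I) \<le> q"
    using card_Un_le[of "g ` I" "h1 ` I"] c[of g] c[of h1] assms(3) by linarith
  then obtain h2 where h2: "h2 \<in> F" "\<And>i. i \<in> K2 \<Longrightarrow> h2 i = g i"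
      "\<And>i. i \<in> I - K2 \<Longrightarrow> h2 i \<notin> g ` I \<union> h1 ` I"
    using richE[OF rich[OF K(2) g], of "g ` I \<union> h1 ` I"] assms(1) by auto
  have KI: "K1 \<subseteq> I" "K2 \<subseteq> I" using K assms(2) by auto
  have "agree I h1 h2 = K1 \<inter> K2"
  proof (intro equalityI subsetI)
    fix i assume "i \<in> agree I h1 h2"
    then have i: "i \<in> I" "h1 i = h2 i" by (auto simp: agree_def)
    have "i \<in> K2" using h2(3)[of i] i by (metis DiffI UnI2 imageI)
    moreover have "i \<in> K1" using h1(3)[of i] i h2(2)[OF \<open>i \<in> K2\<close>] by (metis DiffI imageI)
    ultimately show "i \<in> K1 \<inter> K2" by simp
  next
    fix i assume "i \<in> K1 \<inter> K2"
    then show "i \<in> agree I h1 h2" using h1(2) h2(2) KI by (auto simp: agree_def)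
  qed
  then show ?thesis using agree h1(1) h2(1) by metis
qed

text \<open>Averaging over all colourings \<open>\<chi>\<close> of \<open>W\<close>.\<close>

lemma colour_classes:
  fixes F :: "('i \<Rightarrow> 'w) set"
  assumes "finite W" "finite I" "I \<noteq> {}" "finite F"
    and inj: "\<And>g. g \<in> F \<Longrightarrow> inj_on g I \<and> g ` I \<subseteq> W"
  obtains \<chi> :: "'w \<Rightarrow> 'i" where "card F \<le> card I ^ card I * card {g \<in> F. \<forall>k\<in>I. \<chi> (g k) = k}"
proof -
  let ?C = "W \<rightarrow>\<^sub>E I"
  let ?p = "card I"
  have p: "0 < ?p" using assms by (simp add: card_gt_0_iff)
  have finC: "finite ?C" using assms by (simp add: finite_PiE)
  \<comment> \<open>A member \<open>g\<close> prescribes the colours of its \<open>card I\<close>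
    values and leaves all others free, so it is correctly coloured by the fraction
    \<open>1 / ?p ^ ?p\<close> of all colourings.\<close>
  have cnt: "?p ^ ?p * card {\<chi> \<in> ?C. \<forall>k\<in>I. \<chi> (g k) = k} = ?p ^ card W" if "g \<in> F" for g
  proof -
    have gI: "inj_on g I" "g ` I \<subseteq> W" using inj[OF that] by auto
    have "{\<chi> \<in> ?C. \<forall>k\<in>I. \<chi> (g k) = k} = (\<Pi>\<^sub>E w\<in>W. if w \<in> g ` I then {the_inv_into I g w} else I)"
      (is "?L = ?R")
    proof (intro equalityI subsetI)
      fix \<chi> assume "\<chi> \<in> ?L"
      then show "\<chi> \<in> ?R" using gI by (auto simp: PiE_iff the_inv_into_f_f)
    next
      fix \<chi> assume chi: "\<chi> \<in> ?R"
      have "\<chi> (g k) = k" if "k \<in> I" for k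
        using PiE_mem[OF chi, of "g k"] that gI by (auto simp: the_inv_into_f_f)
      moreover have "\<chi> w \<in> I" if "w \<in> W" for w
        using PiE_mem[OF chi that] gI(1) by (auto split: if_splits simp: the_inv_into_f_f)
      ultimately show "\<chi> \<in> ?L" using chi by (auto simp: PiE_iff)
    qed
    then have "card {\<chi> \<in> ?C. \<forall>k\<in>I. \<chi> (g k) = k} =
        (\<Prod>w\<in>W. card (if w \<in> g ` I then {the_inv_into I g w} else I))"
      using assms(1) by (simp add: card_PiE)
    also have "\<dots> = (\<Prod>w\<in>W. if w \<in> g ` I then 1 else ?p)" by (intro prod.cong) auto
    also have "\<dots> = ?p ^ card (W - g ` I)"
      using assms(1) by (simp add: prod.If_cases Diff_eq)
    also have "?p ^ ?p * \<dots> = ?p ^ card W"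
      using gI assms(1) card_image[OF gI(1)] card_mono[OF assms(1) gI(2)]
      by (simp add: card_Diff_subset finite_subset[OF gI(2)] flip: power_add)
    finally show ?thesis .
  qed
  have "card F * ?p ^ card W = (\<Sum>g\<in>F. ?p ^ ?p * card {\<chi> \<in> ?C. \<forall>k\<in>I. \<chi> (g k) = k})"
    using cnt by simp
  also have "\<dots> = ?p ^ ?p * (\<Sum>g\<in>F. \<Sum>\<chi>\<in>?C. if \<forall>k\<in>I. \<chi> (g k) = k then 1 else 0)"
    using finC by (simp add: sum_distrib_left sum.If_cases Int_def)
  also have "(\<Sum>g\<in>F. \<Sum>\<chi>\<in>?C. if \<forall>k\<in>I. \<chi> (g k) = k then 1 else 0) =
     (\<Sum>\<chi>\<in>?C. card {g \<in> F. \<forall>k\<in>I. \<chi> (g k) = k})"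
    using assms(4) by (subst sum.swap) (simp add: sum.If_cases Int_def)
  finally have eq: "card F * ?p ^ card W = (\<Sum>\<chi>\<in>?C. ?p ^ ?p * card {g \<in> F. \<forall>k\<in>I. \<chi> (g k) = k})"
    by (simp add: sum_distrib_left)
  have "\<exists>\<chi>\<in>?C. card F \<le> ?p ^ ?p * card {g \<in> F. \<forall>k\<in>I. \<chi> (g k) = k}"
  proof (rule ccontr)
    assume "\<not> ?thesis"
    then have "(\<Sum>\<chi>\<in>?C. ?p ^ ?p * card {g \<in> F. \<forall>k\<in>I. \<chi> (g k) = k}) < (\<Sum>\<chi>\<in>?C. card F)"
      using finC assms(3) by (intro sum_strict_mono) (auto simp: not_le PiE_eq_empty_iff)
    also have "\<dots> = card F * ?p ^ card W" using assms(1) by (simp add: card_PiE)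
    finally show False using eq by simp
  qed
  then show thesis using that by blast
qed

section \<open>Centres of edges\<close>

lemma blowup_free_mono:
  assumes "blowup_free a b T U V W H" "H' \<subseteq> H"
  shows "blowup_free a b T U V W H'"
  using assms unfolding blowup_free_def contains_copy_def by (meson subsetD)

text \<open>The vertices of \<open>D\<close> are exchanged one at a time. More than \<open>q\<close>
  edges contain the current edge without \<open>d\<close>, they differ in a single vertex, and
  \<open>X\<close> can block at most \<open>q\<close> of them.\<close>

lemma swap_vertices:
  assumes H: "\<And>e. e \<in> H \<Longrightarrow> finite e \<and> card e = r" and "finite H" and X: "finite X" "card X \<le> q"
    and codeg: "\<And>e y. e \<in> H \<Longrightarrow> y \<in> e \<Longrightarrow> q < card {e' \<in> H. e - {y} \<subseteq> e'}"
    and e: "e \<in> H" and D: "D \<subseteq> e"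
  shows "\<exists>e'\<in>H. e - D \<subseteq> e' \<and> e' \<inter> X \<subseteq> e - D"
proof -
  have "finite D" using D H[OF e] finite_subset by blast
  then show ?thesis using D
  proof (induction D rule: finite_induct)
    case empty
    then show ?case using e by auto
  next
    case (insert d D)
    obtain e' where e': "e' \<in> H" "e - D \<subseteq> e'" "e' \<inter> X \<subseteq> e - D"
      using insert by auto
    have d: "d \<in> e'" using insert e' by auto
    define R where "R = {f \<in> H. e' - {d} \<subseteq> f}"
    have single: "\<exists>z. f = insert z (e' - {d}) \<and> z \<notin> e' - {d}" if "f \<in> R" for f
    proof -
      have f: "f \<in> H" "e' - {d} \<subseteq> f" using that by (auto simp: R_def)
      have "card (f - (e' - {d})) = card f - card (e' - {d})"
        using f H[OF e'(1)] by (intro card_Diff_subset) auto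
      also have "\<dots> = 1" using H[OF f(1)] H[OF e'(1)] d
        by (metis card_Diff_singleton card_gt_0_iff diff_diff_cancel empty_iff less_eq_Suc_le One_nat_def)
      finally obtain z where "f - (e' - {d}) = {z}" by (auto simp: card_1_singleton_iff)
      then show ?thesis using f by (intro exI[of _ z]) auto
    qed
    have "\<exists>z. z \<notin> X \<and> insert z (e' - {d}) \<in> H"
    proof (rule ccontr)
      assume "\<not> ?thesis"
      then have nX: "z \<in> X" if "insert z (e' - {d}) \<in> H" for z using that by blast
      have "R \<subseteq> (\<lambda>z. insert z (e' - {d})) ` X"
      proof
        fix f assume f: "f \<in> R"
        then obtain z where z: "f = insert z (e' - {d})" using single by blast
        have "f \<in> H" using f by (simp add: R_def)
        then show "f \<in> (\<lambda>z. insert z (e' - {d})) ` X" using z nX by blast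
      qed
      then have "card R \<le> card X" using X(1) by (rule surj_card_le[rotated])
      then show False using codeg[OF e'(1) d] X(2) by (simp add: R_def)
    qed
    then obtain z where z: "z \<notin> X" "insert z (e' - {d}) \<in> H" by blast
    show ?case using z e'(2,3) by (intro bexI[OF _ z(2)]) auto
  qed
qed

text \<open>If all codegrees are larger, every split of an edge into an \<open>a\<close>-set and a
  \<open>b\<close>-set is a frame either part of which can be renewed by
  \<open>swap_vertices\<close>, and nothing has to be reserved. The bound is the number of vertices
  of the blowup, hence of all vertices that a partial embedding may have used.\<close>

lemma exists_low_codegree:
  assumes T: "undirected_tree T" and bip: "bipartition T U V" and x: "critical_leaf T V x"
    and W: "finite W" and H: "\<And>e. e \<in> H \<Longrightarrow> e \<subseteq> W \<and> card e = a + b" and free: "blowup_free a b T U V W H"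
    and ne: "H \<noteq> {}"
  shows "\<exists>e\<in>H. \<exists>y\<in>e. card {e' \<in> H. e - {y} \<subseteq> e'} \<le> card U * a + card V * b"
proof (rule ccontr)
  let ?q = "card U * a + card V * b"
  assume "\<not> ?thesis"
  then have codeg: "\<And>e y. e \<in> H \<Longrightarrow> y \<in> e \<Longrightarrow> ?q < card {e' \<in> H. e - {y} \<subseteq> e'}"
    by (meson not_le)
  have finH: "finite H" using H W by (meson finite_Pow_iff finite_subset subsetI PowI)
  have He: "finite e \<and> card e = a + b" if "e \<in> H" for e using H[OF that] W finite_subset by blast
  define F where "F = {(A, B). A \<union> B \<in> H \<and> A \<inter> B = {} \<and> card A = a \<and> card B = b}"
  \<comment> \<open>The part sizes are left open so that the same fact renews the
    \<open>b\<close>-set and, applied to reversed pairs, the \<open>a\<close>-set.\<close>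
  have swap: "\<exists>B'. (A, B') \<in> F' \<and> B' \<inter> X = {}"
    if F': "F' = {(A, B). A \<union> B \<in> H \<and> A \<inter> B = {} \<and> card A = a' \<and> card B = b'}" and ab: "a' + b' = a + b"
      and AB: "(A, B) \<in> F'" and X: "X \<subseteq> W" "card X \<le> ?q" for A B X a' b' F'
  proof -
    have AB': "A \<union> B \<in> H" "A \<inter> B = {}" "card A = a'" "card B = b'" using AB F' by auto
    obtain e' where e': "e' \<in> H" "(A \<union> B) - B \<subseteq> e'" "e' \<inter> X \<subseteq> (A \<union> B) - B"
      using swap_vertices[OF He finH finite_subset[OF X(1) W] X(2) codeg AB'(1), of B] by auto
    have A: "A \<subseteq> e'" using e'(2) AB'(2) by blast
    have "card (e' - A) = b'"
      using card_Diff_subset[OF _ A] finite_subset[OF A] He[OF e'(1)] AB'(3) ab by auto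
    then have "(A, e' - A) \<in> F'" using A AB' e'(1) F' by (auto simp: Un_absorb1)
    moreover have "(e' - A) \<inter> X = {}" using e'(3) by blast
    ultimately show ?thesis by blast
  qed
  obtain e where e: "e \<in> H" using ne by blast
  obtain A0 where A0: "A0 \<subseteq> e" "card A0 = a"
    using obtain_subset_with_card_n[of a e] He[OF e] by auto
  have "card (e - A0) = b" using card_Diff_subset[OF _ A0(1)] finite_subset[OF A0(1)] He[OF e] A0(2) by auto
  then have g0: "(A0, e - A0) \<in> F" using A0 e by (auto simp: F_def Un_absorb1)
  have "\<not> blowup_free a b T U V W H"
  proof (rule blowup_embedding[OF T bip x, where F = F and Aset = fst and Bset = "\<lambda>_. snd" and P = "\<lambda>_. {}"])
    show "(A0, e - A0) \<in> F" by (rule g0)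
    show "card (e - A0) = b" "fst (A0, e - A0) \<inter> (e - A0) = {}" "fst (A0, e - A0) \<union> (e - A0) \<in> H"
      using g0 by (auto simp: F_def)
  next
    fix g :: "'b set \<times> 'b set" and v X assume g: "g \<in> F" and X: "X \<subseteq> W" "card X \<le> ?q"
    have "\<exists>B'. (fst g, B') \<in> F \<and> B' \<inter> X = {}"
      using swap[of F a b "fst g" "snd g" X] g X by (simp add: F_def)
    then obtain B' where "(fst g, B') \<in> F" "B' \<inter> X = {}" by blast
    then show "\<exists>h\<in>F. fst h = fst g \<and> snd h \<inter> X \<subseteq> {}" by (intro bexI[of _ "(fst g, B')"]) auto
    define F' where "F' = {(A, B). A \<union> B \<in> H \<and> A \<inter> B = {} \<and> card A = b \<and> card B = a}"
    have eq: "(A, B) \<in> F' \<longleftrightarrow> (B, A) \<in> F" for A B by (auto simp: F'_def F_def Un_commute Int_commute)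
    have "\<exists>B'. (snd g, B') \<in> F' \<and> B' \<inter> X = {}"
      by (rule swap[of F' b a "snd g" "fst g" X]) (use g X eq in \<open>simp_all add: F'_def\<close>)
    then obtain B' where "(B', snd g) \<in> F" "B' \<inter> X = {}" using eq by blast
    then show "\<exists>h\<in>F. snd h = snd g \<and> fst h \<inter> X = {}" by (intro bexI[of _ "(B', snd g)"]) auto
  next
    fix g assume "g \<in> F"
    then have "fst g \<union> snd g \<in> H" "card (fst g) = a" by (auto simp: F_def)
    then show "fst g \<subseteq> W \<and> card (fst g) = a" using H by blast
  qed (use W H in \<open>auto simp: F_def\<close>)
  then show False using free by blast
qed

text \<open>
  If an edge contains a set \<open>Y\<close>, one vertex smaller, of codegree at most \<open>K\<close>, then the edges
  containing \<open>Y\<close> are removed and get the vertex outside \<open>Y\<close> as centre.  Otherwise all codegrees are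
  large and the tree can be embedded.
\<close>

lemma assign_centres:
  assumes T: "undirected_tree T" and bip: "bipartition T U V" and x: "critical_leaf T V x"
    and W: "finite W" and H: "\<And>e. e \<in> H \<Longrightarrow> e \<subseteq> W \<and> card e = a + b" and free: "blowup_free a b T U V W H"
  shows "\<exists>c. (\<forall>e\<in>H. c e \<in> e) \<and> (\<forall>Y. card {e \<in> H. e - {c e} = Y} \<le> card U * a + card V * b)"
proof -
  have "finite H" using H W by (meson finite_Pow_iff finite_subset subsetI PowI)
  then show ?thesis using H free
  proof (induction "card H" arbitrary: H rule: less_induct)
    case less
    show ?case
    proof (cases "H = {}")
      case True
      then show ?thesis by auto
    next
      case False
      obtain e y where e: "e \<in> H" "y \<in> e" "card {e' \<in> H. e - {y} \<subseteq> e'} \<le> card U * a + card V * b"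
        using exists_low_codegree[OF T bip x W less.prems(2,3) False] by blast
      define Y0 R where "Y0 = e - {y}" and "R = {e' \<in> H. Y0 \<subseteq> e'}"
      have fin: "finite e" if "e \<in> H" for e using less.prems(2)[OF that] W finite_subset by blast
      have Y0: "finite Y0" "card Y0 = a + b - 1" "0 < a + b"
        using e fin[OF e(1)] less.prems(2)[OF e(1)] by (auto simp: Y0_def card_gt_0_iff)
      have "H - R \<subset> H" using e by (auto simp: R_def Y0_def)
      then have lt: "card (H - R) < card H" using less.prems(1) psubset_card_mono by blast
      have fr': "blowup_free a b T U V W (H - R)" using blowup_free_mono[OF less.prems(3)] by blast
      obtain c where c: "\<forall>e\<in>H - R. c e \<in> e"
        "\<forall>Y. card {e \<in> H - R. e - {c e} = Y} \<le> card U * a + card V * b"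
        using less.hyps[OF lt _ less.prems(2) fr'] less.prems(1) by blast
      have "\<exists>z. z \<in> f \<and> f - {z} = Y0" if "f \<in> R" for f
      proof -
        have f: "f \<in> H" "Y0 \<subseteq> f" using that by (auto simp: R_def)
        have "card (f - Y0) = 1"
          using card_Diff_subset[OF Y0(1) f(2)] Y0 less.prems(2)[OF f(1)] by simp
        then obtain z where "f - Y0 = {z}" by (auto simp: card_1_singleton_iff)
        then show ?thesis using f(2) by (intro exI[of _ z]) auto
      qed
      then obtain d where d: "\<And>f. f \<in> R \<Longrightarrow> d f \<in> f \<and> f - {d f} = Y0" by metis
      define c' where "c' = (\<lambda>f. if f \<in> R then d f else c f)"
      \<comment> \<open>Edges of \<open>R\<close> are charged to \<open>Y0\<close> only, and edges
        outside \<open>R\<close> do not contain \<open>Y0\<close>; so no set is charged both now and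
        by the induction hypothesis.\<close>
      have "card {f \<in> H. f - {c' f} = Y} \<le> card U * a + card V * b" for Y
      proof (cases "Y = Y0")
        case True
        have "{f \<in> H. f - {c' f} = Y} \<subseteq> R" using True by (auto simp: R_def)
        then have "card {f \<in> H. f - {c' f} = Y} \<le> card R"
          using less.prems(1) by (intro card_mono) (auto simp: R_def)
        then show ?thesis using e(3) by (simp add: R_def Y0_def)
      next
        case False
        have "{f \<in> H. f - {c' f} = Y} \<subseteq> {f \<in> H - R. f - {c f} = Y}"
          using False d by (auto simp: c'_def)
        then have "card {f \<in> H. f - {c' f} = Y} \<le> card {f \<in> H - R. f - {c f} = Y}"
          using less.prems(1) by (intro card_mono) auto
        then show ?thesis using c(2) order_trans by blast
      qed
      moreover have "\<forall>f\<in>H. c' f \<in> f" using c(1) d by (auto simp: c'_def)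
      ultimately show ?thesis by blast
    qed
  qed
qed

section \<open>Homogeneous frames\<close>

text \<open>Here \<open>N\<close> stands for the redundant positions of an edge. By
  \<open>redundant_unique\<close> the closure of one part can enter the other part only if that
  other part holds exactly one element of \<open>N\<close>.\<close>

lemma balanced_split:
  assumes E: "finite E" "card E = a + b" and N: "N \<subseteq> E" "2 \<le> card N" and ab: "b < a" "2 \<le> b"
  obtains A where "A \<subseteq> E" "card A = a" "card (N \<inter> A) \<noteq> 1" "card (N - A) \<noteq> 1"
proof -
  have finN: "finite N" using E N finite_subset by blast
  have cN: "card N \<le> a + b" using E N card_mono by metis
  \<comment> \<open>All of \<open>N\<close> goes into \<open>A\<close> if it fits. Otherwise
    \<open>A\<close> is filled from \<open>N\<close>, except that two elements are left over where
    it would be one; then \<open>a - 1\<close> is not 1 because \<open>2 \<le> b\<close> and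
    \<open>b < a\<close>.\<close>
  define k where "k = (if card N \<le> a then card N else if card N = a + 1 then a - 1 else a)"
  have k: "k \<noteq> 1" "k \<le> card N" "card N - k \<noteq> 1" "k \<le> a" "card N - k \<le> b"
    using N ab cN by (auto simp: k_def)
  obtain A1 where A1: "A1 \<subseteq> N" "card A1 = k" "finite A1"
    using obtain_subset_with_card_n[OF k(2)] by metis
  have "card (E - N) = a + b - card N" using E N finN by (simp add: card_Diff_subset)
  then have "a - k \<le> card (E - N)" using k cN by linarith
  then obtain A2 where A2: "A2 \<subseteq> E - N" "card A2 = a - k" "finite A2"
    by (rule obtain_subset_with_card_n)
  have "card (A1 \<union> A2) = a" using A1 A2 k by (subst card_Un_disjoint) auto
  moreover have "N \<inter> (A1 \<union> A2) = A1" "N - (A1 \<union> A2) = N - A1" using A1 A2 by auto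
  moreover have "card (N - A1) = card N - k" using A1 by (simp add: card_Diff_subset)
  moreover have "A1 \<union> A2 \<subseteq> E" using A1 A2 N(1) by blast
  ultimately show thesis using that[of "A1 \<union> A2"] A1(2) k by simp
qed

section \<open>Closures of position sets\<close>

locale intersection_family =
  fixes I :: "'i set" and J :: "'i set set"
  assumes finite_I: "finite I" and J_sub: "J \<subseteq> Pow I" and I_in: "I \<in> J"
    and Int_closed: "K1 \<in> J \<Longrightarrow> K2 \<in> J \<Longrightarrow> K1 \<inter> K2 \<in> J"
begin

text \<open>For the agreement sets \<open>J\<close> of a homogeneous family and
  \<open>Q \<subseteq> I\<close> these are the positions determined by \<open>Q\<close>: members
  that agree on \<open>Q\<close> agree on \<open>cl Q\<close>, and outside \<open>cl Q\<close> the
  values can be renewed.\<close>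

definition cl :: "'i set \<Rightarrow> 'i set" where "cl Q = \<Inter>{K \<in> J. Q \<subseteq> K}"

lemma cl_in: assumes "Q \<subseteq> I" shows "cl Q \<in> J"
proof -
  have "\<Inter>S \<in> J" if "finite S" "S \<noteq> {}" "S \<subseteq> J" for S
    using that by (induction S rule: finite_ne_induct) (auto intro: Int_closed)
  moreover have "finite {K \<in> J. Q \<subseteq> K}"
    by (rule finite_subset[of _ "Pow I"]) (use J_sub finite_I in auto)
  moreover have "{K \<in> J. Q \<subseteq> K} \<noteq> {}" using assms I_in by blast
  ultimately show ?thesis unfolding cl_def by blast
qed

lemma subset_cl: "Q \<subseteq> cl Q"
  by (auto simp: cl_def)

lemma cl_least: "Q \<subseteq> K \<Longrightarrow> K \<in> J \<Longrightarrow> cl Q \<subseteq> K"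
  by (auto simp: cl_def)

lemma cl_subset: "P \<subseteq> cl Q \<Longrightarrow> Q \<subseteq> I \<Longrightarrow> cl P \<subseteq> cl Q"
  by (rule cl_least) (simp_all add: cl_in)

lemma cl_mono: "P \<subseteq> Q \<Longrightarrow> cl P \<subseteq> cl Q"
  by (auto simp: cl_def)

lemma cl_sub_I: "Q \<subseteq> I \<Longrightarrow> cl Q \<subseteq> I"
  using cl_in J_sub by blast

text \<open>
  An element \<open>z\<close> of \<open>cl Q - Q\<close> makes \<open>E - {z}\<close> span; a second such element outside \<open>Q\<close> could be
  dropped as well, leaving a spanning set that is too small.
\<close>

lemma redundant_unique:
  assumes E: "E \<subseteq> I" "M \<subseteq> E" "card E = Suc m"
    and rank: "\<And>Q. Q \<subseteq> E \<Longrightarrow> card Q \<le> m - 1 \<Longrightarrow> \<not> M \<subseteq> cl Q"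
    and Q: "Q \<subseteq> E" and z: "z \<in> E" "z \<notin> Q" "z \<in> cl Q"
  shows "{z \<in> E. M \<subseteq> cl (E - {z})} - Q = {z}"
proof -
  have "z \<in> cl (E - {z})" using cl_mono[of Q "E - {z}"] Q z by blast
  then have "E \<subseteq> cl (E - {z})" using subset_cl[of "E - {z}"] by blast
  then have "M \<subseteq> cl (E - {z})" using E(2) by blast
  moreover have "z' = z" if z': "z' \<in> E" "M \<subseteq> cl (E - {z'})" "z' \<notin> Q" for z'
  proof (rule ccontr)
    assume ne: "z' \<noteq> z"
    let ?D = "E - {z, z'}"
    have "z \<in> cl ?D" using cl_mono[of Q ?D] Q z z' by blast
    then have "E - {z'} \<subseteq> cl ?D" using subset_cl[of ?D] by blast
    then have "cl (E - {z'}) \<subseteq> cl ?D" by (rule cl_subset) (use E in blast)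
    then have "M \<subseteq> cl ?D" using z'(2) by blast
    moreover have "card ?D \<le> m - 1" 
      using E z z' ne finite_subset[OF E(1) finite_I] by (simp add: card_Diff_subset)
    moreover have "?D \<subseteq> E" by blast
    ultimately show False using rank[of ?D] by simp
  qed
  ultimately show ?thesis using z by blast
qed

end

text \<open>With \<open>p\<close> positions, \<open>p ^ p\<close> is the loss in passing to
  correctly coloured members and the other factor the loss in \<open>homogeneous_subfamily\<close>.
  What matters is that \<open>card W\<close> does not occur.\<close>

definition hom_const :: "nat \<Rightarrow> nat \<Rightarrow> nat" where
  "hom_const p q = p ^ p * (2 * (2 * (p * q) * 2 ^ p) ^ (2 ^ p))"

lemma homogeneous_coloured_subfamily:
  fixes F :: "('i \<Rightarrow> 'w) set"
  assumes "finite W" "finite I" "I \<noteq> {}" "finite F" "q > 0"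
    and inj: "\<And>g. g \<in> F \<Longrightarrow> inj_on g I \<and> g ` I \<subseteq> W"
  obtains \<chi> F' J where "F' \<subseteq> F" "J \<subseteq> Pow I" "card F \<le> hom_const (card I) q * card F'"
    "\<And>g k. g \<in> F' \<Longrightarrow> k \<in> I \<Longrightarrow> \<chi> (g k) = k"
    "\<And>K g. K \<in> J \<Longrightarrow> g \<in> F' \<Longrightarrow> rich q I F' K g"
    "\<And>g h. g \<in> F' \<Longrightarrow> h \<in> F' \<Longrightarrow> agree I g h \<in> J"
proof -
  obtain \<chi> :: "'w \<Rightarrow> 'i" where chi: "card F \<le> card I ^ card I * card {g \<in> F. \<forall>k\<in>I. \<chi> (g k) = k}"
    using colour_classes[OF assms(1-4) inj] by blast
  define G where "G = {g \<in> F. \<forall>k\<in>I. \<chi> (g k) = k}"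
  have "finite G" using assms(4) by (simp add: G_def)
  obtain F' J where FJ: "F' \<subseteq> G" "J \<subseteq> Pow I"
    "card G \<le> 2 * (2 * (card I * q) * 2 ^ card I) ^ (2 ^ card I) * card F'"
    "\<And>K g. K \<in> J \<Longrightarrow> g \<in> F' \<Longrightarrow> rich q I F' K g"
    "\<And>g h. g \<in> F' \<Longrightarrow> h \<in> F' \<Longrightarrow> agree I g h \<in> J"
    using homogeneous_subfamily[OF \<open>finite G\<close> assms(2,3,5)] by blast
  have "card F \<le> card I ^ card I * (2 * (2 * (card I * q) * 2 ^ card I) ^ (2 ^ card I) * card F')"
    using chi FJ(3) unfolding G_def[symmetric] by (meson mult_le_mono2 order_trans)
  then have c: "card F \<le> hom_const (card I) q * card F'" by (simp only: hom_const_def mult.assoc)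
  have s: "F' \<subseteq> F" "\<And>g k. g \<in> F' \<Longrightarrow> k \<in> I \<Longrightarrow> \<chi> (g k) = k" using FJ(1) by (auto simp: G_def)
  show thesis by (rule that[OF s(1) FJ(2) c s(2) FJ(4,5)])
qed

text \<open>Richness is available only at members of \<open>J\<close>, so it is used at
  \<open>cl P\<close>. This is the source of both extension properties that
  \<open>blowup_embedding\<close> asks for.\<close>

lemma (in intersection_family) rich_extension:
  assumes rich: "\<And>K g. K \<in> J \<Longrightarrow> g \<in> F \<Longrightarrow> rich q I F K g"
    and g: "g \<in> F" and P: "P \<subseteq> I" and R: "R \<subseteq> I" "cl P \<inter> R = {}" and X: "finite X" "card X \<le> q"
  shows "\<exists>h\<in>F. (\<forall>k\<in>P. h k = g k) \<and> h ` R \<inter> X = {}"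
proof -
  obtain h where h: "h \<in> F" "\<And>i. i \<in> cl P \<Longrightarrow> h i = g i" "\<And>i. i \<in> I - cl P \<Longrightarrow> h i \<notin> X"
    using richE[OF rich[OF cl_in[OF P] g] X] by blast
  have "h k = g k" if "k \<in> P" for k using h(2) subset_cl that by blast
  moreover have "h k \<notin> X" if "k \<in> R" for k using h(3) R that by blast
  ultimately show ?thesis using h(1) by blast
qed

text \<open>
  Positions below \<open>m\<close> hold an \<open>m\<close>-set \<open>Y\<close>, the positions \<open>Suc m + j\<close> with \<open>j < t - 1\<close> hold centres of
  \<open>Y\<close>, the position \<open>m\<close> holds the replacement of the vertex at position \<open>i\<close>, and the position
  \<open>m + t\<close> a centre of the modified set.  If for some \<open>j\<close> a second position of the \<open>j\<close>-th edge is
  redundant, the tree is embedded into copies of that edge alone.  Otherwise every vertex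
  of \<open>V - {x}\<close> gets a centre position of its own, and the critical leaf \<open>x\<close> uses \<open>m\<close> and \<open>m + t\<close>.
\<close>

lemma homogeneous_frames_embedding:
  fixes F :: "(nat \<Rightarrow> 'w) set"
  assumes T: "undirected_tree T" and bip: "bipartition T U V" and x: "critical_leaf T V x"
    and W: "finite W" and H: "\<And>e. e \<in> H \<Longrightarrow> e \<subseteq> W"
    and t: "card V = t" and ab: "b < a" "2 \<le> b" and m: "Suc m = a + b" and i: "i < m" and I: "I = {..m + t}"
    and fam: "intersection_family I J" and "F \<noteq> {}"
    and inj: "\<And>g. g \<in> F \<Longrightarrow> inj_on g I \<and> g ` I \<subseteq> W"
    and col: "\<And>g k. g \<in> F \<Longrightarrow> k \<in> I \<Longrightarrow> \<chi> (g k) = k"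
    and rich: "\<And>K g. K \<in> J \<Longrightarrow> g \<in> F \<Longrightarrow> rich q I F K g" and q: "card U * a + card V * b \<le> q"
    and rank: "\<And>Q. Q \<subseteq> I \<Longrightarrow> card Q \<le> m - 1 \<Longrightarrow> \<not> {..<m} \<subseteq> intersection_family.cl J Q"
    and edge: "\<And>g j. g \<in> F \<Longrightarrow> j < t - 1 \<Longrightarrow> g ` insert (Suc m + j) {..<m} \<in> H"
    and root: "\<And>g. g \<in> F \<Longrightarrow> g ` ({..m} - {i} \<union> {m + t}) \<in> H"
  shows "\<not> blowup_free a b T U V W H"
proof -
  interpret intersection_family I J by (rule fam)
  interpret G: pair_graph T using T by (simp add: undirected_tree_def)
  have xV: "x \<in> V" using x by (simp add: critical_leaf_def)
  have finV: "finite V" using bip G.pair_finite_verts by (metis bipartition_def finite_Un)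
  have tpos: "0 < t" using t finV xV by (auto simp: card_gt_0_iff)
  obtain g0 where g0: "g0 \<in> F" using \<open>F \<noteq> {}\<close> by blast
  let ?M = "{..<m}"
  have MI: "?M \<subseteq> I" by (auto simp: I)
  have cimg: "card (g ` S) = card S" if "g \<in> F" "S \<subseteq> I" for g S
    using inj[OF that(1)] that(2) by (intro card_image) (auto intro: inj_on_subset)
  have dimg: "g ` S \<inter> g ` S' = {}" if "g \<in> F" "S \<subseteq> I" "S' \<subseteq> I" "S \<inter> S' = {}" for g S S'
    using inj[OF that(1)] that(2-4) by (metis image_empty inj_on_image_Int)
  have simg: "g ` S \<subseteq> W" if "g \<in> F" "S \<subseteq> I" for g S
    using inj[OF that(1)] that(2) by blast
  define E where "E j = insert (Suc m + j) ?M" for j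
  \<comment> \<open>The redundant positions of the \<open>j\<close>-th edge. Two of its
    \<open>m + 1\<close> positions cannot be dropped together, since by \<open>rank\<close> the
    \<open>m - 1\<close> remaining ones do not span \<open>?M\<close>; \<open>red\<close> draws the
    consequence for closures.\<close>
  define N where "N j = {z \<in> E j. ?M \<subseteq> cl (E j - {z})}" for j
  have EI: "E j \<subseteq> I" if "j < t - 1" for j using that by (auto simp: E_def I)
  have cE: "card (E j) = Suc m" "finite (E j)" for j by (auto simp: E_def)
  have ME: "?M \<subseteq> E j" for j by (auto simp: E_def)
  have red: "N j - Q = {z}" if "j < t - 1" "Q \<subseteq> E j" "z \<in> E j" "z \<notin> Q" "z \<in> cl Q" for j Q z
    unfolding N_def
    by (rule redundant_unique[OF EI[OF that(1)] ME cE(1) _ that(2-5)])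
      (use rank EI[OF that(1)] in blast)
  show ?thesis
  proof (cases "\<exists>j<t - 1. 2 \<le> card (N j)")
    case True
    then obtain j where j: "j < t - 1" "2 \<le> card (N j)" by blast
    have "N j \<subseteq> E j" by (auto simp: N_def)
    have cE': "card (E j) = a + b" using cE m by simp
    obtain A where A: "A \<subseteq> E j" "card A = a" "card (N j \<inter> A) \<noteq> 1" "card (N j - A) \<noteq> 1"
      using balanced_split[OF cE(2) cE' \<open>N j \<subseteq> E j\<close> j(2) ab] by blast
    define B where "B = E j - A"
    have B: "B \<subseteq> E j" "card B = b" "A \<inter> B = {}" "A \<union> B = E j"
      using A(1,2) cE' cE(2) finite_subset[OF A(1)] by (auto simp: B_def card_Diff_subset)
    have AI: "A \<subseteq> I" "B \<subseteq> I" using A B EI[OF j(1)] by auto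
    have clA: "cl A \<inter> B = {}"
    proof (rule ccontr)
      assume "\<not> ?thesis"
      then obtain z where "z \<in> cl A" "z \<in> B" by blast
      then have "N j - A = {z}" using red[OF j(1) A(1)] B_def by blast
      then show False using A(4) by simp
    qed
    have clB: "cl B \<inter> A = {}"
    proof (rule ccontr)
      assume "\<not> ?thesis"
      then obtain z where "z \<in> cl B" "z \<in> A" by blast
      then have "N j - B = {z}" using red[OF j(1) B(1)] A(1) B_def by blast
      moreover have "N j - B = N j \<inter> A" using \<open>N j \<subseteq> E j\<close> A(1) by (auto simp: B_def)
      ultimately show False using A(3) by simp
    qed
    have ed: "g ` A \<union> g ` B \<in> H" if "g \<in> F" for g
      using edge[OF that j(1)] B(4) unfolding E_def by (simp flip: image_Un)
    show ?thesis
    proof (rule blowup_embedding[where W = W and H = H and F = F and Aset = "\<lambda>g. g ` A"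
          and Bset = "\<lambda>_ g. g ` B" and P = "\<lambda>_. {}" and Z = "g0 ` B", OF T bip x _ W _ _ _ _ g0])
      fix g v X assume g: "g \<in> F" and X: "X \<subseteq> W" "card X \<le> card U * a + card V * b"
      have X': "finite X" "card X \<le> q" using X W q finite_subset by auto
      show "\<exists>h\<in>F. h ` A = g ` A \<and> h ` B \<inter> X \<subseteq> {}"
        using rich_extension[OF rich g AI clA X'] by (metis image_cong subset_refl)
      show "\<exists>h\<in>F. h ` B = g ` B \<and> h ` A \<inter> X = {}"
        using rich_extension[OF rich g AI(2,1) clB X'] by (metis image_cong)
    next
      fix g v assume g: "g \<in> F"
      show "card (g ` B) = b \<and> g ` A \<inter> g ` B = {} \<and> g ` A \<union> g ` B \<in> H"
        using cimg[OF g AI(2)] B(2) dimg[OF g AI B(3)] ed[OF g] by simp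
    next
      show "card (g0 ` B) = b" "g0 ` A \<inter> g0 ` B = {}" "g0 ` A \<union> g0 ` B \<in> H"
        using cimg[OF g0 AI(2)] B(2) dimg[OF g0 AI B(3)] ed[OF g0] by simp_all
    qed (use cimg[OF _ AI(1)] simg[OF _ AI(1)] A(2) H in simp_all)
  next
    case False
    \<comment> \<open>Since \<open>?M\<close> spans itself, the centre is always redundant; in this
      case nothing else is.\<close>
    have Nj: "N j = {Suc m + j}" if "j < t - 1" for j
    proof -
      have "Suc m + j \<in> N j" using subset_cl[of ?M] by (auto simp: N_def E_def)
      moreover have "card (N j) \<le> 1" using False that by force
      moreover have "finite (N j)" using cE(2)[of j] by (simp add: N_def)
      ultimately show ?thesis by (metis card_le_Suc0_iff_eq One_nat_def singletonI insertCI
            equalityI subsetI singletonD)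
    qed
    \<comment> \<open>Avoiding the exchanged position \<open>i\<close> makes \<open>A\<close> part
      of the modified edge as well, so that \<open>x\<close> can be attached to it. There is room
      for this because \<open>2 \<le> b\<close>.\<close>
    have "a \<le> card (?M - {i})" using i m ab by simp
    then obtain A where A: "A \<subseteq> ?M - {i}" "card A = a" "finite A" by (rule obtain_subset_with_card_n)
    define B where "B = ?M - A"
    have "A \<subseteq> ?M" using A(1) by blast
    then have "card B = m - a" using A(2,3) by (simp add: B_def card_Diff_subset)
    then have B: "B \<subseteq> ?M" "card B = b - 1" "A \<inter> B = {}" "A \<union> B = ?M" "i \<in> B" "finite B"
      using A(1) m i by (auto simp: B_def)
    have AI: "A \<subseteq> I" "B \<subseteq> I" using A B MI by auto
    obtain \<kappa> where kap: "bij_betw \<kappa> (V - {x}) {..<t - 1}"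
      using ex_bij_betw_finite_nat[of "V - {x}"] finV xV t by (auto simp: lessThan_atLeast0)
    have kap_less: "\<kappa> v < t - 1" if "v \<in> V - {x}" for v using kap that by (auto simp: bij_betw_def)
    define c where "c v = Suc m + \<kappa> v" for v
    have c_inj: "c v \<noteq> c v'" if "v \<in> V - {x}" "v' \<in> V - {x}" "v \<noteq> v'" for v v'
      using kap that by (auto simp: c_def bij_betw_def inj_on_def)
    have cI: "c v \<in> I" "m < c v" "c v < m + t" if "v \<in> V - {x}" for v
      using kap_less[OF that] by (auto simp: c_def I)
    have ABm: "k < m" if "k \<in> A \<union> B" for k using B(4) that by auto
    \<comment> \<open>The value at \<open>c v\<close> may be forced by the values on
      \<open>A\<close>, so it cannot be required to be fresh. The colour class of \<open>c v\<close>
      is reserved instead; in a frame no other position takes values in it.\<close>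
    define P where "P v = {w. \<chi> w = c v}" for v
    have Pimg: "g ` S \<inter> P v = {}" if "g \<in> F" "S \<subseteq> I" "c v \<notin> S" for g S v
      using col[OF that(1)] that(2,3) by (auto simp: P_def)
    \<comment> \<open>In the set for the leaf the position \<open>i\<close> gives way to its
      replacement \<open>m\<close>, and \<open>m + t\<close> is the new centre; the size is
      \<open>(b - 2) + 2\<close>.\<close>
    define X0 where "X0 = g0 ` (B - {i} \<union> {m, m + t})"
    have X0I: "B - {i} \<union> {m, m + t} \<subseteq> I" using B(1) by (auto simp: I)
    \<comment> \<open>A position of \<open>B\<close> in the closure of \<open>A\<close> would let
      \<open>?M\<close> be spanned by \<open>m - 1\<close> of its own positions.\<close>
    have clA: "cl A \<inter> B = {}"
    proof (rule ccontr)
      assume "\<not> ?thesis"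
      then obtain z where z: "z \<in> cl A" "z \<in> B" by blast
      have "A \<subseteq> ?M - {z}" using A(1) z B(3) by blast
      then have "z \<in> cl (?M - {z})" using z(1) cl_mono by blast
      then have "?M \<subseteq> cl (?M - {z})" using subset_cl[of "?M - {z}"] by blast
      moreover have "card (?M - {z}) \<le> m - 1" "?M - {z} \<subseteq> I" using z B(1) MI by auto
      ultimately show False using rank by blast
    qed
    \<comment> \<open>A position of \<open>A\<close> in this closure would by \<open>red\<close> be
      redundant, but the only redundant position is \<open>c v\<close> itself.\<close>
    have clB: "cl (insert (c v) B) \<inter> A = {}" if v: "v \<in> V - {x}" for v
    proof (rule ccontr)
      assume "\<not> ?thesis"
      then obtain z where z: "z \<in> cl (insert (c v) B)" "z \<in> A" by blast
      have sub: "insert (c v) B \<subseteq> E (\<kappa> v)" using B(1) by (auto simp: E_def c_def)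
      have "z \<in> E (\<kappa> v)" "z \<notin> insert (c v) B" using z(2) A(1) B(3) by (auto simp: E_def c_def)
      then have "N (\<kappa> v) - insert (c v) B = {z}" using red[OF kap_less[OF v] sub] z(1) by blast
      then show False using Nj[OF kap_less[OF v]] by (simp add: c_def)
    qed
    have cB: "insert (c v) B \<subseteq> I" "card (insert (c v) B) = b" "A \<inter> insert (c v) B = {}"
      if "v \<in> V - {x}" for v
    proof -
      have "c v \<notin> A \<union> B" using ABm cI(2)[OF that] by (meson less_asym)
      then show "insert (c v) B \<subseteq> I" "card (insert (c v) B) = b" "A \<inter> insert (c v) B = {}"
        using cI(1)[OF that] AI B(2,3,6) ab by auto
    qed
    show ?thesis
    proof (rule blowup_embedding[where W = W and H = H and F = F and Aset = "\<lambda>g. g ` A"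
          and Bset = "\<lambda>v g. g ` insert (c v) B" and P = P and Z = X0, OF T bip x _ W _ _ _ _ g0])
      fix g v assume g: "g \<in> F" and v: "v \<in> V - {x}"
      have "A \<union> insert (c v) B = insert (Suc m + \<kappa> v) ?M" using B(4) by (auto simp: c_def)
      then have "g ` A \<union> g ` insert (c v) B \<in> H"
        using edge[OF g kap_less[OF v]] by (metis image_Un)
      then show "card (g ` insert (c v) B) = b \<and> g ` A \<inter> g ` insert (c v) B = {} \<and>
          g ` A \<union> g ` insert (c v) B \<in> H"
        using cimg[OF g cB(1)[OF v]] cB[OF v] dimg[OF g AI(1) cB(1)[OF v]] by simp
      show "g ` A \<inter> P v = {}" 
        using Pimg[OF g AI(1)] ABm cI(2)[OF v] by (meson UnI1 less_asym)
      fix v' assume v': "v' \<in> V - {x}" "v \<noteq> v'"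
      have "c v' \<notin> insert (c v) B"
        using c_inj[OF v v'] ABm cI(2)[OF v'(1)] by (metis UnI2 insertE less_asym)
      then show "g ` insert (c v) B \<inter> P v' = {}" by (rule Pimg[OF g cB(1)[OF v]])
    next
      fix v assume v: "v \<in> V - {x}"
      have "c v \<notin> B - {i} \<union> {m, m + t}" using ABm[of "c v"] cI[OF v] by auto
      then show "X0 \<inter> P v = {}" unfolding X0_def by (rule Pimg[OF g0 X0I])
    next
      have "card (B - {i} \<union> {m, m + t}) = card (B - {i}) + card {m, m + t}"
        by (rule card_Un_disjoint) (use B in auto)
      also have "\<dots> = b" using B tpos ab by simp
      finally show "card X0 = b" unfolding X0_def using cimg[OF g0 X0I] by simp
      have "A \<inter> (B - {i} \<union> {m, m + t}) = {}" using B(3) ABm by fastforce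
      then show "g0 ` A \<inter> X0 = {}" unfolding X0_def by (rule dimg[OF g0 AI(1) X0I])
      have "A \<union> (B - {i} \<union> {m, m + t}) = {..m} - {i} \<union> {m + t}"
        using B(4) A(1) i by (auto simp: B_def)
      then show "g0 ` A \<union> X0 \<in> H" unfolding X0_def using root[OF g0] by (metis image_Un)
    next
      fix g v X assume g: "g \<in> F" and v: "v \<in> V - {x}"
        and X: "X \<subseteq> W" "card X \<le> card U * a + card V * b"
      have X': "finite X" "card X \<le> q" using X W q finite_subset by auto
      obtain h where h: "h \<in> F" "\<forall>k\<in>A. h k = g k" "h ` B \<inter> X = {}"
        using rich_extension[OF rich g AI clA X'] by blast
      have "h (c v) \<in> P v" using col[OF h(1) cI(1)[OF v]] by (simp add: P_def)
      then have "h ` insert (c v) B \<inter> X \<subseteq> P v" using h(3) by blast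
      moreover have "h ` A = g ` A" using h(2) by (simp cong: image_cong)
      ultimately show "\<exists>h\<in>F. h ` A = g ` A \<and> h ` insert (c v) B \<inter> X \<subseteq> P v" using h(1) by blast
      show "\<exists>h\<in>F. h ` insert (c v) B = g ` insert (c v) B \<and> h ` A \<inter> X = {}"
        using rich_extension[OF rich g cB(1)[OF v] AI(1) clB[OF v] X'] by (metis image_cong)
    qed (use cimg[OF _ AI(1)] simg[OF _ AI(1)] A(2) H in simp_all)
  qed
qed

text \<open>
  Replacing the \<open>i\<close>-th vertex of \<open>\<sigma>\<close> by \<open>y\<close> creates a centre that is not among \<open>t - 1\<close> chosen
  centres of \<open>\<sigma>\<close>.  The other conditions make the vertices of the resulting frame distinct.
\<close>

definition bad_swaps :: "'w set \<Rightarrow> ('w set \<Rightarrow> 'w set) \<Rightarrow> ('w set \<Rightarrow> nat \<Rightarrow> 'w) \<Rightarrow> nat \<Rightarrow> nat \<Rightarrow> nat \<Rightarrow>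
    ((nat \<Rightarrow> 'w) \<times> 'w) set" where
  "bad_swaps W C cc m t i = {(\<sigma>, y) \<in> ({..<m} \<rightarrow>\<^sub>E W) \<times> W. inj_on \<sigma> {..<m} \<and> t - 1 \<le> card (C (\<sigma> ` {..<m})) \<and>
     y \<noteq> \<sigma> i \<and> y \<notin> C (\<sigma> ` {..<m}) \<and> \<sigma> i \<notin> C ((\<sigma>(i := y)) ` {..<m}) \<and>
     \<not> C ((\<sigma>(i := y)) ` {..<m}) \<subseteq> cc (\<sigma> ` {..<m}) ` {..<t - 1}}"

text \<open>A larger number of bad swaps leaves more than \<open>card W ^ m\<close> frames after
  homogenization, and these satisfy the hypotheses of \<open>homogeneous_frames_embedding\<close>.
  In \<open>q\<close> the summand \<open>2 * Suc (m + t)\<close> serves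
  \<open>homogeneous_Int_closed\<close>; the rest is the number of vertices of the blowup.\<close>

lemma card_bad_swaps_le:
  fixes W :: "'w set"
  assumes T: "undirected_tree T" and bip: "bipartition T U V" and x: "critical_leaf T V x"
    and W: "finite W" and H: "\<And>e. e \<in> H \<Longrightarrow> e \<subseteq> W \<and> card e = a + b" and free: "blowup_free a b T U V W H"
    and t: "card V = t" "0 < t" and ab: "b < a" "2 \<le> b" and m: "Suc m = a + b" and i: "i < m"
    and C: "\<And>Y c. c \<in> C Y \<Longrightarrow> c \<notin> Y \<and> insert c Y \<in> H"
    and cc: "\<And>Y. t - 1 \<le> card (C Y) \<Longrightarrow> inj_on (cc Y) {..<t - 1} \<and> cc Y ` {..<t - 1} \<subseteq> C Y"
    and q: "q = 2 * Suc (m + t) + card U * a + card V * b"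
  shows "card (bad_swaps W C cc m t i) \<le> hom_const (Suc (m + t)) q * card W ^ m"
proof (rule ccontr)
  let ?M = "{..<m}"
  define Bad where "Bad = bad_swaps W C cc m t i"
  define I where "I = {..m + t}"
  assume "\<not> ?thesis"
  then have large: "hom_const (card I) q * card W ^ m < card Bad" by (simp add: Bad_def I_def)
  define c' where "c' p = (SOME c. c \<in> C (((fst p)(i := snd p)) ` ?M) \<and> c \<notin> cc (fst p ` ?M) ` {..<t - 1})" for p
  define fr where "fr p k = (if k < m then fst p k else if k = m then snd p
      else if k < m + t then cc (fst p ` ?M) (k - Suc m) else c' p)" for p k
  have Badp: "\<sigma> \<in> ?M \<rightarrow>\<^sub>E W" "y \<in> W" "inj_on \<sigma> ?M" "t - 1 \<le> card (C (\<sigma> ` ?M))"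
     "y \<noteq> \<sigma> i" "y \<notin> C (\<sigma> ` ?M)" "\<sigma> i \<notin> C ((\<sigma>(i := y)) ` ?M)"
     "\<not> C ((\<sigma>(i := y)) ` ?M) \<subseteq> cc (\<sigma> ` ?M) ` {..<t - 1}" if "(\<sigma>, y) \<in> Bad" for \<sigma> y
    using that by (auto simp: Bad_def bad_swaps_def)
  have c': "c' (\<sigma>, y) \<in> C ((\<sigma>(i := y)) ` ?M)" "c' (\<sigma>, y) \<notin> cc (\<sigma> ` ?M) ` {..<t - 1}"
    if "(\<sigma>, y) \<in> Bad" for \<sigma> y
  proof -
    have "\<exists>c. c \<in> C ((\<sigma>(i := y)) ` ?M) \<and> c \<notin> cc (\<sigma> ` ?M) ` {..<t - 1}"
      using Badp(8)[OF that] by blast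
    from someI_ex[OF this] show "c' (\<sigma>, y) \<in> C ((\<sigma>(i := y)) ` ?M)" "c' (\<sigma>, y) \<notin> cc (\<sigma> ` ?M) ` {..<t - 1}"
      by (simp_all add: c'_def)
  qed
  \<comment> \<open>If \<open>y\<close> repeated another entry, the modified tuple would have fewer
    than \<open>m\<close> values, and adding a centre could not give an edge.\<close>
  have ynot: "y \<notin> \<sigma> ` ?M" if p: "(\<sigma>, y) \<in> Bad" for \<sigma> y
  proof
    assume "y \<in> \<sigma> ` ?M"
    then obtain k where k: "k < m" "y = \<sigma> k" by auto
    have ki: "k \<noteq> i" using k Badp(5)[OF p] by auto
    let ?s = "\<sigma>(i := y)"
    have e: "c' (\<sigma>, y) \<notin> ?s ` ?M" "insert (c' (\<sigma>, y)) (?s ` ?M) \<in> H" using C[OF c'(1)[OF p]] by auto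
    have "card (insert (c' (\<sigma>, y)) (?s ` ?M)) = Suc (card (?s ` ?M))"
      by (rule card_insert_disjoint) (use e in auto)
    then have "card (?s ` ?M) = card ?M" using H[OF e(2)] m by simp
    then have "inj_on ?s ?M" by (simp add: eq_card_imp_inj_on)
    then have "?s k \<noteq> ?s i" using ki k i by (auto simp: inj_on_def)
    then show False using ki k by simp
  qed
  have frI: "inj_on (fr p) I \<and> fr p ` I \<subseteq> W" if "p \<in> Bad" for p
  proof -
    obtain \<sigma> y where p: "p = (\<sigma>, y)" by (cases p)
    then have pB: "(\<sigma>, y) \<in> Bad" using that by simp
    note B = Badp[OF pB] and c = c'[OF pB] and yn = ynot[OF pB]
    have ccC: "inj_on (cc (\<sigma> ` ?M)) {..<t - 1}" "cc (\<sigma> ` ?M) ` {..<t - 1} \<subseteq> C (\<sigma> ` ?M)"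
      using cc[OF B(4)] by auto
    have CW: "z \<in> W" "z \<notin> Y" if "z \<in> C Y" for z Y using C[OF that] H by auto
    have f1: "fr p k = \<sigma> k" if "k < m" for k using that by (simp add: fr_def p)
    have f2: "fr p m = y" by (simp add: fr_def p)
    have f3: "fr p k = cc (\<sigma> ` ?M) (k - Suc m)" if "m < k" "k < m + t" for k
      using that by (simp add: fr_def p)
    have f4: "fr p (m + t) = c' (\<sigma>, y)" using t by (simp add: fr_def p)
    have "fr p k \<noteq> fr p l" if kl: "k < l" "l \<in> I" for k l
    proof -
      consider "l < m" | "l = m" | "m < l" "l < m + t" | "l = m + t" using kl(2) by (force simp: I_def)
      then show ?thesis
      proof cases
        case 1
        then show ?thesis using kl(1) B(3) f1 by (auto simp: inj_on_def)
      next
        case 2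
        then have "fr p k \<in> \<sigma> ` ?M" using kl(1) f1[of k] by auto
        then show ?thesis using 2 f2 yn by metis
      next
        case 3
        then have l: "fr p l \<in> C (\<sigma> ` ?M)" using f3[of l] ccC(2) by auto
        consider "k < m" | "k = m" | "m < k" by linarith
        then show ?thesis
        proof cases
          case 1
          then have "fr p k \<in> \<sigma> ` ?M" using f1[of k] by auto
          then show ?thesis using CW(2)[OF l] by metis
        next
          case 2
          then show ?thesis using f2 B(6) l by metis
        next
          case k3: 3
          have "k - Suc m \<noteq> l - Suc m" "k - Suc m < t - 1" "l - Suc m < t - 1" using 3 k3 kl(1) by auto
          then show ?thesis using ccC(1) f3[of k] f3[of l] 3 k3 kl(1) by (auto simp: inj_on_def)
        qed
      next
        case 4
        then have l: "fr p l \<in> C ((\<sigma>(i := y)) ` ?M)" "fr p l \<notin> cc (\<sigma> ` ?M) ` {..<t - 1}"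
          using f4 c by auto
        have l': "fr p l \<notin> (\<sigma>(i := y)) ` ?M" by (rule CW(2)[OF l(1)])
        consider "k < m" "k \<noteq> i" | "k = i" | "k = m" | "m < k" by linarith
        then show ?thesis
        proof cases
          case 1
          then have "fr p k = (\<sigma>(i := y)) k" using f1 by simp
          then have "fr p k \<in> (\<sigma>(i := y)) ` ?M" using 1(1) by blast
          then show ?thesis using l' by metis
        next
          case 2
          then show ?thesis using f1[of i] i B(7) l(1) by metis
        next
          case 3
          have "y = (\<sigma>(i := y)) i" by simp
          then have "y \<in> (\<sigma>(i := y)) ` ?M" using i by blast
          then show ?thesis using 3 f2 l' by metis
        next
          case k4: 4
          have "fr p k \<in> cc (\<sigma> ` ?M) ` {..<t - 1}" using f3[of k] k4 4 kl(1) by auto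
          then show ?thesis using l(2) by metis
        qed
      qed
    qed
    then have "inj_on (fr p) I" by (intro linorder_inj_onI) auto
    moreover have "fr p k \<in> W" if kI: "k \<in> I" for k
    proof -
      consider "k < m" | "k = m" | "m < k" "k < m + t" | "k = m + t" using kI by (force simp: I_def)
      then show ?thesis
      proof cases
        case 3
        then have "fr p k \<in> C (\<sigma> ` ?M)" using f3[of k] ccC(2) by auto
        then show ?thesis by (rule CW)
      qed (use f1[of k] f2 f4 B(1,2) CW(1)[OF c(1)] in auto)
    qed
    ultimately show ?thesis by blast
  qed
  \<comment> \<open>The centres in a frame are fixed choices depending on the bad swap, which is
    read off from the positions up to \<open>m\<close>.\<close>
  have det0: "p = p'" if "p \<in> Bad" "p' \<in> Bad" "\<And>k. k \<le> m \<Longrightarrow> fr p k = fr p' k" for p p'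
  proof -
    have "fst p k = fst p' k" if "k < m" for k using \<open>\<And>k. k \<le> m \<Longrightarrow> fr p k = fr p' k\<close>[of k] that by (simp add: fr_def)
    moreover have "fst p \<in> ?M \<rightarrow>\<^sub>E W" "fst p' \<in> ?M \<rightarrow>\<^sub>E W" using that(1,2) Badp(1)[of "fst p" "snd p"] Badp(1)[of "fst p'" "snd p'"] by simp_all
    ultimately have "fst p = fst p'" by (intro PiE_ext) auto
    moreover have "snd p = snd p'" using that(3)[of m] by (simp add: fr_def)
    ultimately show ?thesis by (simp add: prod_eq_iff)
  qed
  have injfr: "inj_on fr Bad" by (rule inj_onI) (use det0 in metis)
  have finI: "finite I" "I \<noteq> {}" "card I = Suc (m + t)" by (auto simp: I_def)
  have "finite Bad" 
    by (rule finite_subset[of _ "(?M \<rightarrow>\<^sub>E W) \<times> W"]) (use W in \<open>auto simp: Bad_def bad_swaps_def intro: finite_PiE\<close>)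
  obtain \<chi> F J where F: "F \<subseteq> fr ` Bad" "J \<subseteq> Pow I" "card (fr ` Bad) \<le> hom_const (card I) q * card F"
    "\<And>g k. g \<in> F \<Longrightarrow> k \<in> I \<Longrightarrow> \<chi> (g k) = k"
    "\<And>K g. K \<in> J \<Longrightarrow> g \<in> F \<Longrightarrow> rich q I F K g"
    "\<And>g h. g \<in> F \<Longrightarrow> h \<in> F \<Longrightarrow> agree I g h \<in> J"
  proof (rule homogeneous_coloured_subfamily[OF W finI(1,2), of "fr ` Bad" q])
    show "finite (fr ` Bad)" using \<open>finite Bad\<close> by simp
    show "0 < q" by (simp add: q)
    show "\<And>g. g \<in> fr ` Bad \<Longrightarrow> inj_on g I \<and> g ` I \<subseteq> W" using frI by blast
  qed blast
  have cF: "card W ^ m < card F"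
  proof (rule ccontr)
    assume "\<not> ?thesis"
    then have "hom_const (card I) q * card F \<le> hom_const (card I) q * card W ^ m"
      by (intro mult_le_mono2) simp
    then show False using large F(3) card_image[OF injfr] by linarith
  qed
  then have Fne: "F \<noteq> {}" by auto
  then obtain g0 where g0: "g0 \<in> F" by blast
  have FI: "inj_on g I \<and> g ` I \<subseteq> W" if "g \<in> F" for g using that F(1) frI by blast
  have det: "g = h" if gh: "g \<in> F" "h \<in> F" "{..m} \<subseteq> agree I g h" for g h
  proof -
    obtain p p' where p: "p \<in> Bad" "g = fr p" "p' \<in> Bad" "h = fr p'" using gh(1,2) F(1) by blast
    then have "p = p'" using gh(3) by (intro det0) (auto simp: agree_def)
    then show ?thesis using p by simp
  qed
  have "I \<in> J" using F(6)[OF g0 g0] by (simp add: agree_def)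
  have fam: "intersection_family I J"
  proof
    fix K1 K2 assume "K1 \<in> J" "K2 \<in> J"
    then show "K1 \<inter> K2 \<in> J"
      by (intro homogeneous_Int_closed[OF finI(1) F(2) _ Fne F(5,6)]) (simp add: q finI(3))
  qed (use finI F(2) \<open>I \<in> J\<close> in auto)
  interpret intersection_family I J by (rule fam)
  have Wpos: "0 < card W" using FI[OF g0] finI(2) W by (auto simp: card_gt_0_iff)
  have rank0: "cl Q \<noteq> I" if Q: "Q \<subseteq> I" "card Q \<le> m" for Q
  proof
    assume cl: "cl Q = I"
    have finQ: "finite Q" using Q(1) finI(1) finite_subset by blast
    have "inj_on (\<lambda>g. restrict g Q) F"
    proof (rule inj_onI)
      fix g h assume gh: "g \<in> F" "h \<in> F" "restrict g Q = restrict h Q"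
      have "g k = h k" if "k \<in> Q" for k using gh(3) that by (metis restrict_apply')
      then have "Q \<subseteq> agree I g h" using Q(1) by (auto simp: agree_def)
      then have "I \<subseteq> agree I g h" using cl cl_least[OF _ F(6)[OF gh(1,2)]] by blast
      then show "g = h" using gh(1,2) by (intro det) (auto simp: I_def)
    qed
    moreover have "(\<lambda>g. restrict g Q) ` F \<subseteq> Q \<rightarrow>\<^sub>E W" using FI Q(1) by fastforce
    ultimately have "card F \<le> card (Q \<rightarrow>\<^sub>E W)"
      using W finQ by (intro card_inj_on_le[of "\<lambda>g. restrict g Q"]) (auto intro: finite_PiE)
    also have "\<dots> = card W ^ card Q" using finQ by (simp add: card_PiE)
    also have "\<dots> \<le> card W ^ m" using Wpos Q(2) by (intro power_increasing) auto
    finally show False using cF by simp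
  qed
  \<comment> \<open>A member that agrees with \<open>g0\<close> up to \<open>m\<close> is
    \<open>g0\<close>, whereas richness would give it new values outside the closure.\<close>
  have span: "cl {..m} = I"
  proof -
    have mI: "{..m} \<subseteq> I" by (auto simp: I_def)
    have "finite (g0 ` I)" "card (g0 ` I) \<le> q" using finI card_image_le[OF finI(1), of g0] by (auto simp: q)
    then obtain h where h: "h \<in> F" "\<And>k. k \<in> cl {..m} \<Longrightarrow> h k = g0 k" "\<And>k. k \<in> I - cl {..m} \<Longrightarrow> h k \<notin> g0 ` I"
      using richE[OF F(5)[OF cl_in[OF mI] g0]] by blast
    have "h k = g0 k" if "k \<le> m" for k using h(2)[of k] subset_cl[of "{..m}"] that by auto
    then have "h = g0" using h(1) g0 mI by (intro det) (auto simp: agree_def)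
    then have "I \<subseteq> cl {..m}" using h(3) by blast
    then show ?thesis using cl_sub_I[OF mI] by blast
  qed
  \<comment> \<open>If \<open>Q\<close> spans \<open>?M\<close>, then \<open>insert m Q\<close>
    spans \<open>{..m}\<close> and hence \<open>I\<close>. The additional position \<open>m\<close>
    lowers the bound from \<open>m\<close> to \<open>m - 1\<close>.\<close>
  have rank: "\<not> ?M \<subseteq> cl Q" if Q: "Q \<subseteq> I" "card Q \<le> m - 1" for Q
  proof
    assume A: "?M \<subseteq> cl Q"
    have Q': "insert m Q \<subseteq> I" "card (insert m Q) \<le> m"
      using Q i card_insert_le_m1[of m Q m] by (auto simp: I_def)
    have "?M \<subseteq> cl (insert m Q)" using A cl_mono[of Q "insert m Q"] by blast
    moreover have "m \<in> cl (insert m Q)" using subset_cl by blast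
    moreover have "{..m} = insert m ?M" by auto
    ultimately have "{..m} \<subseteq> cl (insert m Q)" by simp
    then have "cl {..m} \<subseteq> cl (insert m Q)" by (rule cl_subset) (rule Q'(1))
    then show False using span rank0[OF Q'] cl_sub_I[OF Q'(1)] by blast
  qed
  have "\<not> blowup_free a b T U V W H"
  proof (rule homogeneous_frames_embedding[OF T bip x W _ t(1) ab m i I_def fam Fne FI F(4) F(5) _ rank])
    fix g j assume g: "g \<in> F" and j: "j < t - 1"
    obtain p where p: "p \<in> Bad" "g = fr p" using g F(1) by blast
    obtain \<sigma> y where sy: "p = (\<sigma>, y)" by (cases p)
    have "g ` insert (Suc m + j) ?M = insert (cc (\<sigma> ` ?M) j) (\<sigma> ` ?M)"
      using j by (auto simp: p(2) fr_def sy)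
    moreover have "cc (\<sigma> ` ?M) j \<in> C (\<sigma> ` ?M)" using cc[OF Badp(4)] p(1) sy j by blast
    ultimately show "g ` insert (Suc m + j) ?M \<in> H" using C by metis
  next
    fix g assume g: "g \<in> F"
    obtain p where p: "p \<in> Bad" "g = fr p" using g F(1) by blast
    obtain \<sigma> y where sy: "p = (\<sigma>, y)" by (cases p)
    have "{..m} - {i} \<union> {m + t} = insert (m + t) (insert m (?M - {i}))" using i by auto
    then have "g ` ({..m} - {i} \<union> {m + t}) = insert (c' (\<sigma>, y)) (insert y (\<sigma> ` (?M - {i})))"
      using t by (auto simp: p(2) fr_def sy)
    also have "insert y (\<sigma> ` (?M - {i})) = (\<sigma>(i := y)) ` ?M" using i by (auto simp: image_def)
    finally show "g ` ({..m} - {i} \<union> {m + t}) \<in> H" using C[OF c'(1)] p(1) sy by metis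
  qed (use H in \<open>auto simp: q\<close>)
  then show False using free by blast
qed

section \<open>Counting tuples\<close>

definition centres :: "'w set set \<Rightarrow> ('w set \<Rightarrow> 'w) \<Rightarrow> 'w set \<Rightarrow> 'w set" where
  "centres H ctr Y = {c. c \<notin> Y \<and> insert c Y \<in> H \<and> ctr (insert c Y) = c}"

lemma card_centres:
  assumes "\<And>e. e \<in> H \<Longrightarrow> ctr e \<in> e"
  shows "card (centres H ctr Y) = card {e \<in> H. e - {ctr e} = Y}"
proof (rule bij_betw_same_card[of "\<lambda>c. insert c Y"])
  show "bij_betw (\<lambda>c. insert c Y) (centres H ctr Y) {e \<in> H. e - {ctr e} = Y}"
    by (rule bij_betw_byWitness[where f' = ctr]) (use assms in \<open>auto simp: centres_def insert_absorb\<close>)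
qed

lemma card_tuples_onto:
  assumes "finite Y" "card Y = m" "Y \<subseteq> W"
  shows "card {\<sigma> \<in> {..<m} \<rightarrow>\<^sub>E W. \<sigma> ` {..<m} = Y} = fact m"
proof -
  have "{\<sigma> \<in> {..<m} \<rightarrow>\<^sub>E W. \<sigma> ` {..<m} = Y} = {\<sigma> \<in> {..<m} \<rightarrow>\<^sub>E Y. inj_on \<sigma> {..<m}}" (is "?L = ?R")
  proof (intro equalityI subsetI)
    fix \<sigma> assume "\<sigma> \<in> ?L"
    then have s: "\<sigma> \<in> {..<m} \<rightarrow>\<^sub>E W" "\<sigma> ` {..<m} = Y" by auto
    have "inj_on \<sigma> {..<m}" using s(2) assms(2) by (intro eq_card_imp_inj_on) auto
    moreover have "\<sigma> \<in> {..<m} \<rightarrow>\<^sub>E Y" using s by (auto simp: PiE_iff)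
    ultimately show "\<sigma> \<in> ?R" by simp
  next
    fix \<sigma> assume "\<sigma> \<in> ?R"
    then have s: "\<sigma> \<in> {..<m} \<rightarrow>\<^sub>E Y" "inj_on \<sigma> {..<m}" by auto
    have "\<sigma> ` {..<m} \<subseteq> Y" using s(1) by auto
    moreover have "card (\<sigma> ` {..<m}) = card Y" using card_image[OF s(2)] assms(2) by simp
    ultimately have "\<sigma> ` {..<m} = Y" using assms(1) card_subset_eq by blast
    then show "\<sigma> \<in> ?L" using s(1) assms(3) by (auto simp: PiE_iff)
  qed
  then show ?thesis
    using card_inj_on_subset_funcset[of "{..<m}" Y "{..<m}"] assms by (simp add: fact_prod_rev)
qed

text \<open>Double counting: an edge \<open>e\<close> is counted once for each of the
  \<open>fact m\<close> orderings of \<open>e - {ctr e}\<close>. Tuples with repeated entries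
  contribute nothing, their images being too small.\<close>

lemma sum_card_centres:
  fixes W :: "'w set"
  assumes W: "finite W" and H: "\<And>e. e \<in> H \<Longrightarrow> e \<subseteq> W \<and> card e = Suc m \<and> ctr e \<in> e"
  shows "(\<Sum>\<sigma>\<in>{..<m} \<rightarrow>\<^sub>E W. card (centres H ctr (\<sigma> ` {..<m}))) = fact m * card H"
proof -
  let ?T = "{..<m} \<rightarrow>\<^sub>E W"
  have finH: "finite H" using H W by (meson finite_Pow_iff finite_subset subsetI PowI)
  have finT: "finite ?T" using W by (simp add: finite_PiE)
  have "(\<Sum>\<sigma>\<in>?T. card (centres H ctr (\<sigma> ` {..<m}))) =
      (\<Sum>\<sigma>\<in>?T. \<Sum>e\<in>H. if e - {ctr e} = \<sigma> ` {..<m} then 1 else 0)"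
    using H finH by (simp add: card_centres sum.If_cases Int_def)
  also have "\<dots> = (\<Sum>e\<in>H. \<Sum>\<sigma>\<in>?T. if e - {ctr e} = \<sigma> ` {..<m} then 1 else 0)"
    by (rule sum.swap)
  also have "\<dots> = (\<Sum>e\<in>H. fact m)"
  proof (rule sum.cong)
    fix e assume e: "e \<in> H"
    have fe: "finite e" using H[OF e] W finite_subset by blast
    have "(\<Sum>\<sigma>\<in>?T. if e - {ctr e} = \<sigma> ` {..<m} then 1 else 0) =
        card {\<sigma> \<in> ?T. \<sigma> ` {..<m} = e - {ctr e}}"
      using finT by (simp add: sum.If_cases Int_def eq_commute)
    also have "\<dots> = fact m" by (rule card_tuples_onto) (use H[OF e] fe in auto)
    finally show "(\<Sum>\<sigma>\<in>?T. if e - {ctr e} = \<sigma> ` {..<m} then 1 else 0) = (fact m :: nat)" .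
  qed simp
  finally show ?thesis by simp
qed

text \<open>The map exchanges \<open>y\<close> with the \<open>i\<close>-th entry and is an
  involution. Thus a property of the modified tuple and the old entry is counted as the same
  property of the old tuple and the new entry.\<close>

lemma bij_betw_swap_coordinate:
  fixes m :: nat
  assumes "i < m"
  shows "bij_betw (\<lambda>(\<sigma>, y). (\<sigma>(i := y), \<sigma> i)) (({..<m} \<rightarrow>\<^sub>E W) \<times> W) (({..<m} \<rightarrow>\<^sub>E W) \<times> W)"
proof -
  let ?f = "\<lambda>(\<sigma>, y). (\<sigma>(i := y), \<sigma> i)" and ?A = "({..<m} \<rightarrow>\<^sub>E W) \<times> W"
  have inv: "\<forall>p\<in>?A. ?f (?f p) = p" by auto
  have img: "?f ` ?A \<subseteq> ?A"
  proof (rule image_subsetI)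
    fix p assume p: "p \<in> ?A"
    obtain \<sigma> y where sy: "p = (\<sigma>, y)" "\<sigma> \<in> {..<m} \<rightarrow>\<^sub>E W" "y \<in> W" using p by (cases p) simp
    have "\<sigma>(i := y) \<in> {..<m} \<rightarrow>\<^sub>E W"
    proof (rule PiE_I)
      fix j assume "j \<in> {..<m}"
      then show "(\<sigma>(i := y)) j \<in> W" using sy(3) PiE_mem[OF sy(2)] by simp
    next
      fix j assume "j \<notin> {..<m}"
      then show "(\<sigma>(i := y)) j = undefined" using assms PiE_arb[OF sy(2)] by auto
    qed
    moreover have "\<sigma> i \<in> W" using PiE_mem[OF sy(2)] assms by simp
    ultimately show "?f p \<in> ?A" by (simp add: sy(1))
  qed
  show ?thesis by (rule bij_betw_byWitness[OF inv inv img img])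
qed

lemma sum_swap_coordinate:
  fixes m :: nat
  assumes "i < m"
  shows "(\<Sum>(\<sigma>, y)\<in>({..<m} \<rightarrow>\<^sub>E W) \<times> W. G (\<sigma>(i := y)) (\<sigma> i)) = (\<Sum>(\<sigma>, y)\<in>({..<m} \<rightarrow>\<^sub>E W) \<times> W. G \<sigma> y)"
  using sum.reindex_bij_betw[OF bij_betw_swap_coordinate[OF assms], of "\<lambda>(\<sigma>, y). G \<sigma> y"]
  by (simp add: case_prod_unfold)

lemma card_swap_coordinate:
  fixes m :: nat
  assumes "i < m" "finite W"
  shows "card {(\<sigma>, y) \<in> ({..<m} \<rightarrow>\<^sub>E W) \<times> W. P (\<sigma>(i := y)) (\<sigma> i)} =
    card {(\<sigma>, y) \<in> ({..<m} \<rightarrow>\<^sub>E W) \<times> W. P \<sigma> y}"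
proof -
  have fin: "finite (({..<m} \<rightarrow>\<^sub>E W) \<times> W)" using assms(2) by (intro finite_cartesian_product finite_PiE) auto
  have card: "card {(\<sigma>, y) \<in> ({..<m} \<rightarrow>\<^sub>E W) \<times> W. Q \<sigma> y} =
      (\<Sum>(\<sigma>, y)\<in>({..<m} \<rightarrow>\<^sub>E W) \<times> W. if Q \<sigma> y then 1 else 0)" for Q
    using fin by (simp add: case_prod_unfold sum.If_cases Int_def mem_Times_iff)
  show ?thesis unfolding card by (rule sum_swap_coordinate[OF assms(1)])
qed

text \<open>
  Cauchy--Schwarz in the form \<open>2 s f \<le> s\<^sup>2 + f\<^sup>2\<close> with \<open>s = sqrt (card W)\<close>, where \<open>f \<sigma>\<close>
  counts the members of \<open>B\<close> that agree with \<open>\<sigma>\<close> off the coordinate \<open>i\<close>.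
\<close>

lemma card_le_of_few_swaps:
  fixes W :: "'w set"
  assumes W: "finite W" and i: "i < m" and B: "B \<subseteq> {..<m} \<rightarrow>\<^sub>E W"
    and few: "card {(\<sigma>, y) \<in> ({..<m} \<rightarrow>\<^sub>E W) \<times> W. \<sigma> \<in> B \<and> \<sigma>(i := y) \<in> B} \<le> \<kappa> * card W ^ m"
  shows "2 * sqrt (card W) * card B \<le> (1 + real \<kappa>) * real (card W) ^ m"
proof (cases "card W = 0")
  case True
  then have "{..<m} \<rightarrow>\<^sub>E W = {}" using W i by (auto simp: PiE_eq_empty_iff)
  then show ?thesis using True B i by simp
next
  case False
  let ?T = "{..<m} \<rightarrow>\<^sub>E W" and ?n = "card W"
  have finT: "finite ?T" using W by (simp add: finite_PiE)
  have cT: "card ?T = ?n ^ m" by (simp add: card_PiE)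
  define f where "f \<sigma> = card {y \<in> W. \<sigma>(i := y) \<in> B}" for \<sigma>
  have f_sum: "(\<Sum>y\<in>W. if \<sigma>(i := y) \<in> B then 1 else 0) = f \<sigma>" for \<sigma>
    using W by (simp add: f_def sum.If_cases Int_def)
  have "(\<Sum>\<sigma>\<in>?T. f \<sigma>) = (\<Sum>(\<sigma>, y)\<in>?T \<times> W. if \<sigma>(i := y) \<in> B then 1 else 0)"
    unfolding f_sum[symmetric] by (rule sum.cartesian_product)
  also have "\<dots> = (\<Sum>(\<sigma>, y)\<in>?T \<times> W. if \<sigma> \<in> B then 1 else 0)"
    by (rule sum_swap_coordinate[OF i, of "\<lambda>\<sigma> y. if \<sigma> \<in> B then 1 else 0"])
  also have "\<dots> = (\<Sum>\<sigma>\<in>?T. ?n * (if \<sigma> \<in> B then 1 else 0))"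
    by (subst sum.cartesian_product[symmetric]) simp
  also have "\<dots> = ?n * card B"
    using finT B by (simp add: sum_distrib_left[symmetric] sum.If_cases Int_absorb1)
  finally have s1: "(\<Sum>\<sigma>\<in>?T. f \<sigma>) = ?n * card B" .
  \<comment> \<open>As \<open>f\<close> ignores the coordinate \<open>i\<close>, one factor of
    \<open>f \<sigma> * f \<sigma>\<close> can be expanded into a sum over \<open>y\<close>. The
    swap of coordinates then reduces the sum of squares to the sum of \<open>f\<close> over
    \<open>B\<close>, which is the quantity bounded by \<open>few\<close>.\<close>
  have fupd: "f (\<sigma>(i := y)) = f \<sigma>" for \<sigma> y by (simp add: f_def)
  have "(\<Sum>\<sigma>\<in>?T. f \<sigma> * f \<sigma>) = (\<Sum>\<sigma>\<in>?T. \<Sum>y\<in>W. if \<sigma>(i := y) \<in> B then f (\<sigma>(i := y)) else 0)"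
  proof (rule sum.cong)
    fix \<sigma>
    have "f \<sigma> * f \<sigma> = (\<Sum>y\<in>W. if \<sigma>(i := y) \<in> B then 1 else 0) * f \<sigma>" by (simp only: f_sum)
    also have "\<dots> = (\<Sum>y\<in>W. if \<sigma>(i := y) \<in> B then f (\<sigma>(i := y)) else 0)"
      unfolding fupd sum_distrib_right by (rule sum.cong) auto
    finally show "f \<sigma> * f \<sigma> = \<dots>" .
  qed simp
  also have "\<dots> = (\<Sum>(\<sigma>, y)\<in>?T \<times> W. if \<sigma>(i := y) \<in> B then f (\<sigma>(i := y)) else 0)"
    by (rule sum.cartesian_product)
  also have "\<dots> = (\<Sum>(\<sigma>, y)\<in>?T \<times> W. if \<sigma> \<in> B then f \<sigma> else 0)"
    by (rule sum_swap_coordinate[OF i, of "\<lambda>\<sigma> y. if \<sigma> \<in> B then f \<sigma> else 0"])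
  also have "\<dots> = (\<Sum>\<sigma>\<in>?T. ?n * (if \<sigma> \<in> B then f \<sigma> else 0))"
    by (subst sum.cartesian_product[symmetric]) simp
  also have "\<dots> = ?n * (\<Sum>\<sigma>\<in>B. f \<sigma>)"
    using finT B by (simp add: sum_distrib_left[symmetric] sum.If_cases Int_absorb1)
  finally have s2: "(\<Sum>\<sigma>\<in>?T. f \<sigma> * f \<sigma>) = ?n * (\<Sum>\<sigma>\<in>B. f \<sigma>)" .
  have finB: "finite B" using finT B finite_subset by blast
  have "(\<Sum>\<sigma>\<in>B. f \<sigma>) = card (SIGMA \<sigma>:B. {y \<in> W. \<sigma>(i := y) \<in> B})"
    using finB W by (simp add: f_def)
  also have "(SIGMA \<sigma>:B. {y \<in> W. \<sigma>(i := y) \<in> B}) = {(\<sigma>, y) \<in> ?T \<times> W. \<sigma> \<in> B \<and> \<sigma>(i := y) \<in> B}"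
    using B by auto
  finally have s3: "(\<Sum>\<sigma>\<in>B. f \<sigma>) \<le> \<kappa> * ?n ^ m" using few by simp
  let ?s = "sqrt (real ?n)"
  have "(\<Sum>\<sigma>\<in>?T. 2 * ?s * real (f \<sigma>)) \<le> (\<Sum>\<sigma>\<in>?T. real ?n + real (f \<sigma> * f \<sigma>))"
  proof (rule sum_mono)
    fix \<sigma>
    have "0 \<le> (?s - real (f \<sigma>))\<^sup>2" by simp
    also have "\<dots> = real ?n + (real (f \<sigma>))\<^sup>2 - 2 * ?s * real (f \<sigma>)" by (simp add: power2_diff)
    finally show "2 * ?s * real (f \<sigma>) \<le> real ?n + real (f \<sigma> * f \<sigma>)"
      by (simp add: power2_eq_square)
  qed
  also have "\<dots> = real ?n * real ?n ^ m + real ?n * real (\<Sum>\<sigma>\<in>B. f \<sigma>)"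
  proof -
    have "(\<Sum>\<sigma>\<in>?T. real ?n + real (f \<sigma> * f \<sigma>)) = real (card ?T) * real ?n + real (\<Sum>\<sigma>\<in>?T. f \<sigma> * f \<sigma>)"
      by (simp only: sum.distrib of_nat_sum sum_constant)
    then show ?thesis unfolding s2 cT by simp
  qed
  also have "(\<Sum>\<sigma>\<in>?T. 2 * ?s * real (f \<sigma>)) = 2 * ?s * real (\<Sum>\<sigma>\<in>?T. f \<sigma>)"
    by (simp add: sum_distrib_left)
  finally have "real ?n * (2 * ?s * card B) \<le> real ?n * (real ?n ^ m + real (\<Sum>\<sigma>\<in>B. f \<sigma>))"
    unfolding s1 by (simp add: algebra_simps)
  then have "2 * ?s * card B \<le> real ?n ^ m + real (\<Sum>\<sigma>\<in>B. f \<sigma>)"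
    using False by (simp add: mult_le_cancel_left_pos)
  also have "\<dots> \<le> real ?n ^ m + real (\<kappa> * ?n ^ m)" using s3 by (intro add_left_mono of_nat_mono)
  finally show ?thesis by (simp add: algebra_simps)
qed

text \<open>The coordinates of \<open>\<tau>\<close> are replaced by those of \<open>\<tau>'\<close> one at a time.\<close>

lemma card_unequal_pairs_le:
  fixes W :: "'w set" and C :: "(nat \<Rightarrow> 'w) \<Rightarrow> 'c"
  assumes W: "finite W"
    and E: "\<And>k. k < m \<Longrightarrow> card {(\<sigma>, y) \<in> ({..<m} \<rightarrow>\<^sub>E W) \<times> W. C \<sigma> \<noteq> C (\<sigma>(k := y))} \<le> Eb"
  shows "card {(\<tau>, \<tau>') \<in> ({..<m} \<rightarrow>\<^sub>E W) \<times> ({..<m} \<rightarrow>\<^sub>E W). C \<tau> \<noteq> C \<tau>'} \<le> m * (Eb * card W ^ (m - 1))"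
proof -
  let ?T = "{..<m} \<rightarrow>\<^sub>E W"
  have finT: "finite ?T" using W by (simp add: finite_PiE)
  define h where "h k \<tau> \<tau>' = (\<lambda>j. if j < k then \<tau>' j else \<tau> j)" for k and \<tau> \<tau>' :: "nat \<Rightarrow> 'w"
  have hT: "h k \<tau> \<tau>' \<in> ?T" if "\<tau> \<in> ?T" "\<tau>' \<in> ?T" for k \<tau> \<tau>'
    using that by (auto simp: h_def PiE_iff extensional_def)
  have hSuc: "h (Suc k) \<tau> \<tau>' = (h k \<tau> \<tau>')(k := \<tau>' k)" for k \<tau> \<tau>'
    by (auto simp: h_def fun_eq_iff)
  have h0: "h 0 \<tau> \<tau>' = \<tau>" for \<tau> \<tau>' by (simp add: h_def)
  have hm: "h m \<tau> \<tau>' = \<tau>'" if "\<tau> \<in> ?T" "\<tau>' \<in> ?T" for \<tau> \<tau>'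
    using that by (auto simp: h_def fun_eq_iff PiE_iff extensional_def)
  define S where "S k = {(\<tau>, \<tau>') \<in> ?T \<times> ?T. C (h k \<tau> \<tau>') \<noteq> C (h (Suc k) \<tau> \<tau>')}" for k
  have "{(\<tau>, \<tau>') \<in> ?T \<times> ?T. C \<tau> \<noteq> C \<tau>'} \<subseteq> (\<Union>k\<in>{..<m}. S k)"
  proof clarify
    fix \<tau> \<tau>' assume t: "\<tau> \<in> ?T" "\<tau>' \<in> ?T" "C \<tau> \<noteq> C \<tau>'"
    show "(\<tau>, \<tau>') \<in> (\<Union>k\<in>{..<m}. S k)"
    proof (rule ccontr)
      assume "\<not> ?thesis"
      then have eq: "C (h k \<tau> \<tau>') = C (h (Suc k) \<tau> \<tau>')" if "k < m" for k
        using that t by (auto simp: S_def)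
      have "k \<le> m \<Longrightarrow> C (h k \<tau> \<tau>') = C \<tau>" for k
        by (induction k) (use eq h0 in auto)
      then show False using hm[OF t(1,2)] t(3) by (metis order_refl)
    qed
  qed
  moreover have finS: "finite (S k)" for k
    by (rule finite_subset[of _ "?T \<times> ?T"]) (use finT in \<open>auto simp: S_def\<close>)
  ultimately have "card {(\<tau>, \<tau>') \<in> ?T \<times> ?T. C \<tau> \<noteq> C \<tau>'} \<le> card (\<Union>k\<in>{..<m}. S k)"
    by (intro card_mono) auto
  also have "\<dots> \<le> (\<Sum>k\<in>{..<m}. card (S k))" by (rule card_UN_le) simp
  also have "\<dots> \<le> of_nat (card {..<m}) * (Eb * card W ^ (m - 1))"
  proof (rule sum_bounded_above)
    fix k assume "k \<in> {..<m}"
    then have k: "k < m" by simp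
    define Ek where "Ek = {(\<sigma>, y) \<in> ?T \<times> W. C \<sigma> \<noteq> C (\<sigma>(k := y))}"
    let ?R = "({..<m} - {k}) \<rightarrow>\<^sub>E W"
    \<comment> \<open>The two opposite hybrids contain all entries of both tuples. The first one
      with the entry \<open>\<tau>' k\<close> is an exchange counted by \<open>Ek\<close>; of the
      second one only \<open>m - 1\<close> further entries are needed.\<close>
    define \<Phi> where "\<Phi> = (\<lambda>(\<tau>, \<tau>'). ((h k \<tau> \<tau>', \<tau>' k), restrict (h k \<tau>' \<tau>) ({..<m} - {k})))"
    have "card (S k) \<le> card (Ek \<times> ?R)"
    proof (rule card_inj_on_le[of \<Phi>])
      show "inj_on \<Phi> (S k)"
      proof (rule inj_onI, clarify)
        fix \<tau> \<tau>' \<rho> \<rho>' assume A: "(\<tau>, \<tau>') \<in> S k" "(\<rho>, \<rho>') \<in> S k" "\<Phi> (\<tau>, \<tau>') = \<Phi> (\<rho>, \<rho>')"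
        have h1: "h k \<tau> \<tau>' j = h k \<rho> \<rho>' j" for j using A(3) by (simp add: \<Phi>_def)
        have hk: "\<tau>' k = \<rho>' k" using A(3) by (simp add: \<Phi>_def)
        have h2: "h k \<tau>' \<tau> j = h k \<rho>' \<rho> j" if "j < m" "j \<noteq> k" for j
          using A(3) that by (auto simp: \<Phi>_def dest!: fun_cong[of _ _ j])
        have T: "\<tau> \<in> ?T" "\<tau>' \<in> ?T" "\<rho> \<in> ?T" "\<rho>' \<in> ?T" using A(1,2) by (auto simp: S_def)
        have "\<tau> j = \<rho> j \<and> \<tau>' j = \<rho>' j" if "j < m" for j
          using h1[of j] h2[of j] hk that by (cases "j = k") (auto simp: h_def split: if_splits)
        then show "\<tau> = \<rho> \<and> \<tau>' = \<rho>'" using T by (metis PiE_ext lessThan_iff)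
      qed
      show "\<Phi> ` S k \<subseteq> Ek \<times> ?R"
      proof (rule image_subsetI)
        fix p assume "p \<in> S k"
        moreover obtain \<tau> \<tau>' where p: "p = (\<tau>, \<tau>')" by (cases p)
        ultimately have T: "\<tau> \<in> ?T" "\<tau>' \<in> ?T" "C (h k \<tau> \<tau>') \<noteq> C ((h k \<tau> \<tau>')(k := \<tau>' k))"
          by (auto simp: S_def hSuc)
        have "(h k \<tau> \<tau>', \<tau>' k) \<in> Ek" using hT[OF T(1,2)] T k by (auto simp: Ek_def)
        moreover have "restrict (h k \<tau>' \<tau>) ({..<m} - {k}) \<in> ?R" using hT[OF T(2,1), of k] by auto
        ultimately show "\<Phi> p \<in> Ek \<times> ?R" by (simp add: \<Phi>_def p)
      qed
      have "finite Ek"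
        by (rule finite_subset[of _ "?T \<times> W"]) (use finT W in \<open>auto simp: Ek_def\<close>)
      then show "finite (Ek \<times> ?R)" using W by (auto intro: finite_PiE)
    qed
    also have "\<dots> = card Ek * card W ^ (m - 1)" using k by (simp add: card_cartesian_product card_PiE)
    also have "\<dots> \<le> Eb * card W ^ (m - 1)" using E[OF k] by (simp add: Ek_def)
    finally show "card (S k) \<le> Eb * card W ^ (m - 1)" .
  qed
  finally show ?thesis by simp
qed

text \<open>\<open>Big\<close> and \<open>Exc\<close> are the numbers of \<open>m\<close>-tuples
  whose image has at least \<open>t\<close>, respectively not exactly \<open>t - 1\<close>, centres.
  Each tuple with fewer than \<open>t - 1\<close> centres lowers the edge count, which only tuples
  counted by \<open>Big\<close> can make up for; so a large \<open>H\<close> and a small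
  \<open>Big\<close> force a small \<open>Exc\<close>.\<close>

lemma star_approximation_count:
  fixes W :: "'w set"
  assumes T: "undirected_tree T" and bip: "bipartition T U V" and x: "critical_leaf T V x"
    and W: "finite W" and H: "\<And>e. e \<in> H \<Longrightarrow> e \<subseteq> W \<and> card e = a + b" and free: "blowup_free a b T U V W H"
    and t: "card V = t" "0 < t" "t - 1 \<le> card W" and ab: "b < a" "2 \<le> b" and m: "Suc m = a + b"
    and K: "K = card U * a + card V * b"
    and \<kappa>: "\<kappa> = hom_const (Suc (m + t)) (2 * Suc (m + t) + card U * a + card V * b) + 2 * K + 1"
  shows "\<exists>S\<subseteq>W. card S = t - 1 \<and> (\<exists>Big Exc.
      card {e \<in> H. e \<inter> S = {}} \<le> 2 * K * m * (2 * Exc + \<kappa> * card W ^ (m - 1)) \<and>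
      fact m * card H + Exc \<le> (t - 1) * card W ^ m + (K + 1) * Big \<and>
      2 * sqrt (card W) * real Big \<le> (1 + real \<kappa>) * real (card W) ^ m)"
proof -
  let ?M = "{..<m}" and ?n = "card W" and ?T = "{..<m} \<rightarrow>\<^sub>E W"
  have mpos: "0 < m" using m ab by simp
  obtain ctr where ctr: "\<And>e. e \<in> H \<Longrightarrow> ctr e \<in> e" "\<And>Y. card {e \<in> H. e - {ctr e} = Y} \<le> K"
    using assign_centres[OF T bip x W H free] unfolding K by blast
  define C where "C = centres H ctr"
  have CH: "c \<notin> Y \<and> insert c Y \<in> H" if "c \<in> C Y" for c Y
    using that by (simp add: C_def centres_def)
  have CW: "C Y \<subseteq> W" for Y using CH H by blast
  have finC: "finite (C Y)" for Y using CW W finite_subset by blast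
  have CK: "card (C Y) \<le> K" for Y using card_centres[of H ctr Y] ctr by (simp add: C_def)
  have finT: "finite ?T" using W by (simp add: finite_PiE)
  have finTW: "finite (?T \<times> W)" using finT W by simp
  have cT: "card ?T = ?n ^ m" by (simp add: card_PiE)
  have inj: "inj_on \<sigma> ?M" if ne: "C (\<sigma> ` ?M) \<noteq> {}" for \<sigma>
  proof -
    obtain c where c: "c \<notin> \<sigma> ` ?M" "insert c (\<sigma> ` ?M) \<in> H" using ne CH by blast
    have "card (insert c (\<sigma> ` ?M)) = Suc (card (\<sigma> ` ?M))"
      by (rule card_insert_disjoint) (use c in auto)
    then have "card (\<sigma> ` ?M) = card ?M" using H[OF c(2)] m by simp
    then show ?thesis by (simp add: eq_card_imp_inj_on)
  qed
  have "\<exists>f. t - 1 \<le> card (C Y) \<longrightarrow> inj_on f {..<t - 1} \<and> f ` {..<t - 1} \<subseteq> C Y" for Y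
  proof (cases "t - 1 \<le> card (C Y)")
    case True
    then obtain D where D: "D \<subseteq> C Y" "card D = t - 1" "finite D" by (rule obtain_subset_with_card_n)
    then obtain f where "bij_betw f {..<t - 1} D"
      using ex_bij_betw_nat_finite[of D] by (auto simp: lessThan_atLeast0)
    then show ?thesis using D(1) by (intro exI[of _ f]) (auto simp: bij_betw_def)
  qed simp
  then obtain cc where cc: "\<And>Y. t - 1 \<le> card (C Y) \<Longrightarrow> inj_on (cc Y) {..<t - 1} \<and> cc Y ` {..<t - 1} \<subseteq> C Y"
    by metis
  \<comment> \<open>The nondegeneracy conditions of \<open>bad_swaps\<close> are dropped here. The
    pairs violating them lie in \<open>D1\<close>, \<open>D2\<close> or \<open>D3\<close>, which is
    the origin of \<open>2 * K + 1\<close> in \<open>\<kappa>\<close>.\<close>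
  define D where "D i = {(\<sigma>, y) \<in> ?T \<times> W. inj_on \<sigma> ?M \<and> t - 1 \<le> card (C (\<sigma> ` ?M)) \<and>
    \<not> C ((\<sigma>(i := y)) ` ?M) \<subseteq> cc (\<sigma> ` ?M) ` {..<t - 1}}" for i
  have cD: "card (D i) \<le> \<kappa> * ?n ^ m" if i: "i < m" for i
  proof -
    define D1 where "D1 = {(\<sigma>, y) \<in> ?T \<times> W. y = \<sigma> i}"
    define D2 where "D2 = {(\<sigma>, y) \<in> ?T \<times> W. y \<in> C (\<sigma> ` ?M)}"
    define D3 where "D3 = {(\<sigma>, y) \<in> ?T \<times> W. \<sigma> i \<in> C ((\<sigma>(i := y)) ` ?M)}"
    let ?B = "bad_swaps W C cc m t i"
    have "D i \<subseteq> ?B \<union> D1 \<union> (D2 \<union> D3)"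
      unfolding D_def D1_def D2_def D3_def bad_swaps_def by blast
    moreover have "finite (?B \<union> D1 \<union> (D2 \<union> D3))"
      by (rule finite_subset[OF _ finTW]) (auto simp: D1_def D2_def D3_def bad_swaps_def)
    ultimately have "card (D i) \<le> card (?B \<union> D1 \<union> (D2 \<union> D3))" by (intro card_mono)
    also have "\<dots> \<le> card ?B + card D1 + (card D2 + card D3)"
      by (intro order_trans[OF card_Un_le] add_mono card_Un_le)
    also have "card ?B \<le> hom_const (Suc (m + t)) (2 * Suc (m + t) + card U * a + card V * b) * ?n ^ m"
    proof (rule card_bad_swaps_le[where H = H, OF T bip x W _ free t(1,2) ab m i _ _ refl])
      show "e \<subseteq> W \<and> card e = a + b" if "e \<in> H" for e by (rule H[OF that])
      show "c \<notin> Y \<and> insert c Y \<in> H" if "c \<in> C Y" for c Y by (rule CH[OF that])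
      show "inj_on (cc Y) {..<t - 1} \<and> cc Y ` {..<t - 1} \<subseteq> C Y" if "t - 1 \<le> card (C Y)" for Y
        by (rule cc[OF that])
    qed
    also have "card D1 \<le> ?n ^ m"
    proof -
      have "card D1 \<le> card ?T"
      proof (rule card_inj_on_le[of fst])
        have "snd p = fst p i" if "p \<in> D1" for p using that by (simp add: D1_def case_prod_unfold)
        then show "inj_on fst D1" by (intro inj_onI) (simp add: prod_eq_iff)
        show "fst ` D1 \<subseteq> ?T" by (rule image_subsetI) (simp add: D1_def case_prod_unfold mem_Times_iff)
      qed (rule finT)
      then show ?thesis by (simp add: cT)
    qed
    also have D2: "card D2 \<le> K * ?n ^ m"
    proof -
      have "D2 = (SIGMA \<sigma>:?T. C (\<sigma> ` ?M))" using CW by (auto simp: D2_def)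
      then have "card D2 = (\<Sum>\<sigma>\<in>?T. card (C (\<sigma> ` ?M)))" using finT finC by simp
      also have "\<dots> \<le> of_nat (card ?T) * K" by (rule sum_bounded_above) (rule CK)
      finally show ?thesis by (simp add: cT mult.commute)
    qed
    also have "card D3 = card D2"
      unfolding D2_def D3_def
      by (rule card_swap_coordinate[OF i W, of "\<lambda>\<sigma> y. y \<in> C (\<sigma> ` ?M)"])
    finally show ?thesis using D2 by (simp add: \<kappa> algebra_simps)
  qed
  define Big where "Big = {\<sigma> \<in> ?T. t \<le> card (C (\<sigma> ` ?M))}"
  define Low where "Low = {\<sigma> \<in> ?T. card (C (\<sigma> ` ?M)) < t - 1}"
  define Exc where "Exc = {\<sigma> \<in> ?T. card (C (\<sigma> ` ?M)) \<noteq> t - 1}"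
  have fin: "finite Big" "finite Low" "finite Exc" 
    unfolding Big_def Low_def Exc_def using finT by simp_all
  have ExcT: "Exc \<subseteq> ?T" by (auto simp: Exc_def)
  have "Exc = Low \<union> Big"
  proof (rule set_eqI)
    fix \<sigma>
    have "d \<noteq> t - 1 \<longleftrightarrow> d < t - 1 \<or> t \<le> d" for d using t(2) by arith
    then show "\<sigma> \<in> Exc \<longleftrightarrow> \<sigma> \<in> Low \<union> Big" by (simp add: Exc_def Low_def Big_def) blast
  qed
  moreover have "Low \<inter> Big = {}" by (rule equals0I) (simp add: Low_def Big_def, linarith)
  ultimately have cExc: "card Exc = card Low + card Big" using card_Un_disjoint[OF fin(2,1)] by simp
  have few: "card {(\<sigma>, y) \<in> ?T \<times> W. \<sigma> \<in> Big \<and> \<sigma>(0 := y) \<in> Big} \<le> \<kappa> * ?n ^ m"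
  proof -
    have "{(\<sigma>, y) \<in> ?T \<times> W. \<sigma> \<in> Big \<and> \<sigma>(0 := y) \<in> Big} \<subseteq> D 0"
    proof clarify
      fix \<sigma> y assume s: "\<sigma> \<in> ?T" "y \<in> W" "\<sigma> \<in> Big" "\<sigma>(0 := y) \<in> Big"
      have d: "t \<le> card (C (\<sigma> ` ?M))" "t \<le> card (C ((\<sigma>(0 := y)) ` ?M))" using s by (auto simp: Big_def)
      have "inj_on \<sigma> ?M" using d(1) t(2) by (intro inj) auto
      moreover have "\<not> C ((\<sigma>(0 := y)) ` ?M) \<subseteq> cc (\<sigma> ` ?M) ` {..<t - 1}"
      proof
        assume "C ((\<sigma>(0 := y)) ` ?M) \<subseteq> cc (\<sigma> ` ?M) ` {..<t - 1}"
        then have "card (C ((\<sigma>(0 := y)) ` ?M)) \<le> card {..<t - 1}" by (rule surj_card_le[rotated]) simp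
        then show False using d(2) t(2) by simp
      qed
      moreover have "t - 1 \<le> card (C (\<sigma> ` ?M))" using d(1) by simp
      ultimately show "(\<sigma>, y) \<in> D 0" unfolding D_def using s(1,2) by blast
    qed
    moreover have "finite (D 0)" by (rule finite_subset[OF _ finTW]) (auto simp: D_def)
    ultimately have "card {(\<sigma>, y) \<in> ?T \<times> W. \<sigma> \<in> Big \<and> \<sigma>(0 := y) \<in> Big} \<le> card (D 0)"
      by (intro card_mono)
    then show ?thesis using cD[OF mpos] by simp
  qed
  have "Big \<subseteq> ?T" by (auto simp: Big_def)
  from card_le_of_few_swaps[OF W mpos this few]
  have cBig: "2 * sqrt ?n * real (card Big) \<le> (1 + real \<kappa>) * real ?n ^ m" .
  have total: "(\<Sum>\<sigma>\<in>?T. card (C (\<sigma> ` ?M))) = fact m * card H"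
    unfolding C_def by (rule sum_card_centres[OF W]) (use H ctr m in auto)
  have sumI: "(\<Sum>\<sigma>\<in>?T. if P \<sigma> then k else 0) = k * card {\<sigma> \<in> ?T. P \<sigma>}" for P and k :: nat
    using finT by (simp add: sum.If_cases Int_def mult.commute)
  \<comment> \<open>A tuple in \<open>Low\<close> misses at least one centre, one in
    \<open>Big\<close> has at most \<open>K\<close>. Adding \<open>card Big\<close> to both sides
    afterwards replaces \<open>Low\<close> by \<open>Exc\<close> and \<open>K\<close> by
    \<open>K + 1\<close>.\<close>
  have "fact m * card H + card Low =
      (\<Sum>\<sigma>\<in>?T. card (C (\<sigma> ` ?M)) + (if card (C (\<sigma> ` ?M)) < t - 1 then 1 else 0))"
    unfolding sum.distrib total sumI by (simp add: Low_def)
  also have "\<dots> \<le> (\<Sum>\<sigma>\<in>?T. (t - 1) + (if t \<le> card (C (\<sigma> ` ?M)) then K else 0))"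
  proof (rule sum_mono)
    fix \<sigma>
    show "card (C (\<sigma> ` ?M)) + (if card (C (\<sigma> ` ?M)) < t - 1 then 1 else 0)
        \<le> (t - 1) + (if t \<le> card (C (\<sigma> ` ?M)) then K else 0)"
      using CK[of "\<sigma> ` ?M"] by auto
  qed
  also have "\<dots> = (t - 1) * ?n ^ m + K * card Big"
    unfolding sum.distrib sumI by (simp add: Big_def cT)
  finally have weight: "fact m * card H + card Exc \<le> (t - 1) * ?n ^ m + (K + 1) * card Big"
    unfolding cExc by simp
  have "\<exists>S\<subseteq>W. card S = t - 1 \<and>
      card {e \<in> H. e \<inter> S = {}} \<le> 2 * K * m * (2 * card Exc + \<kappa> * ?n ^ (m - 1))"
  proof (cases "?n ^ m \<le> 2 * card Exc")
    case True
    \<comment> \<open>Here the claimed bound is at least the number of all edges, so any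
      \<open>S\<close> will do. In the other case more than half of the tuples have exactly
      \<open>t - 1\<close> centres.\<close>
    obtain S where S: "S \<subseteq> W" "card S = t - 1" using obtain_subset_with_card_n[OF t(3)] by blast
    have finH: "finite H" using H W by (meson finite_Pow_iff finite_subset subsetI PowI)
    have "card {e \<in> H. e \<inter> S = {}} \<le> card H" by (rule card_mono) (use finH in auto)
    also have "\<dots> \<le> fact m * card H" by simp
    also have "\<dots> \<le> of_nat (card ?T) * K" unfolding total[symmetric] by (rule sum_bounded_above) (rule CK)
    also have "\<dots> \<le> (2 * card Exc) * K" using True by (simp add: cT)
    also have "\<dots> \<le> 2 * K * m * (2 * card Exc + \<kappa> * ?n ^ (m - 1))"
    proof -
      have "2 * K * 1 * (card Exc + 0) \<le> 2 * K * m * (2 * card Exc + \<kappa> * ?n ^ (m - 1))"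
        by (intro mult_le_mono add_mono) (use mpos in auto)
      then show ?thesis by (simp add: mult_ac)
    qed
    finally show ?thesis using S by blast
  next
    case False
    \<comment> \<open>The first summand counts exchanges with a tuple of \<open>Exc\<close> before
      or after. If both tuples have exactly \<open>t - 1\<close> centres, \<open>cc\<close> lists
      all centres of the first one, so a change of centres puts the exchange into
      \<open>D k\<close>.\<close>
    define Eb where "Eb = 2 * (?n * card Exc) + \<kappa> * ?n ^ m"
    have E: "card {(\<sigma>, y) \<in> ?T \<times> W. C (\<sigma> ` ?M) \<noteq> C ((\<sigma>(k := y)) ` ?M)} \<le> Eb" if k: "k < m" for k
    proof -
      define E1 where "E1 = {(\<sigma>, y) \<in> ?T \<times> W. \<sigma> \<in> Exc}"
      define E2 where "E2 = {(\<sigma>, y) \<in> ?T \<times> W. \<sigma>(k := y) \<in> Exc}"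
      have "{(\<sigma>, y) \<in> ?T \<times> W. C (\<sigma> ` ?M) \<noteq> C ((\<sigma>(k := y)) ` ?M)} \<subseteq> E1 \<union> E2 \<union> D k"
      proof clarify
        fix \<sigma> y assume s: "\<sigma> \<in> ?T" "y \<in> W" "C (\<sigma> ` ?M) \<noteq> C ((\<sigma>(k := y)) ` ?M)"
          and n: "(\<sigma>, y) \<notin> D k" "(\<sigma>, y) \<notin> E2"
        show "(\<sigma>, y) \<in> E1"
        proof (rule ccontr)
          assume n1: "(\<sigma>, y) \<notin> E1"
          let ?C = "C (\<sigma> ` ?M)" and ?C' = "C ((\<sigma>(k := y)) ` ?M)"
          have "(\<sigma>(k := y)) \<in> ?T"
          proof (rule PiE_I)
            fix j assume "j \<in> ?M"
            then show "(\<sigma>(k := y)) j \<in> W" using s(2) PiE_mem[OF s(1)] by simp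
          next
            fix j assume "j \<notin> ?M"
            then show "(\<sigma>(k := y)) j = undefined" using k PiE_arb[OF s(1)] by auto
          qed
          then have d: "card ?C = t - 1" "card ?C' = t - 1"
            using n(2) n1 s(1,2) by (simp_all add: E1_def E2_def Exc_def)
          have "cc (\<sigma> ` ?M) ` {..<t - 1} = ?C"
          proof (rule card_subset_eq[OF finC])
            show "cc (\<sigma> ` ?M) ` {..<t - 1} \<subseteq> ?C" using cc d(1) by simp
            show "card (cc (\<sigma> ` ?M) ` {..<t - 1}) = card ?C" using cc[of "\<sigma> ` ?M"] d(1) by (simp add: card_image)
          qed
          moreover have "\<not> ?C' \<subseteq> ?C" using card_subset_eq[OF finC, of ?C'] d s(3) by metis
          moreover have "?C \<noteq> {}"
          proof
            assume e: "?C = {}"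
            then have "card ?C' = 0" using d by simp
            then show False using e s(3) finC by simp
          qed
          then have "inj_on \<sigma> ?M" by (rule inj)
          ultimately have "(\<sigma>, y) \<in> D k" unfolding D_def using s(1,2) d(1) by simp
          then show False using n(1) by simp
        qed
      qed
      moreover have "finite (E1 \<union> E2 \<union> D k)"
        by (rule finite_subset[OF _ finTW]) (auto simp: E1_def E2_def D_def)
      ultimately have "card {(\<sigma>, y) \<in> ?T \<times> W. C (\<sigma> ` ?M) \<noteq> C ((\<sigma>(k := y)) ` ?M)} \<le> card (E1 \<union> E2 \<union> D k)"
        by (intro card_mono)
      also have "\<dots> \<le> card E1 + card E2 + card (D k)"
        by (intro order_trans[OF card_Un_le] add_mono card_Un_le order_refl)
      also have "card E2 = card E1" unfolding E1_def E2_def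
        by (rule card_swap_coordinate[OF k W, of "\<lambda>\<sigma> y. \<sigma> \<in> Exc"])
      also have "card E1 = ?n * card Exc"
      proof -
        have "E1 = Exc \<times> W" using ExcT by (auto simp: E1_def)
        then show ?thesis by (simp add: card_cartesian_product mult.commute)
      qed
      finally show ?thesis using cD[OF k] by (simp add: Eb_def)
    qed
    define \<Delta> where "\<Delta> = {(\<tau>, \<tau>') \<in> ?T \<times> ?T. C (\<tau> ` ?M) \<noteq> C (\<tau>' ` ?M)}"
    have c\<Delta>: "card \<Delta> \<le> m * (Eb * ?n ^ (m - 1))"
      unfolding \<Delta>_def by (rule card_unequal_pairs_le[OF W, of m "\<lambda>\<sigma>. C (\<sigma> ` ?M)"]) (rule E)
    have nm: "?n ^ m = ?n * ?n ^ (m - 1)" using mpos by (simp add: power_eq_if)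
    define X where "X = 2 * card Exc + \<kappa> * ?n ^ (m - 1)"
    have EbX: "Eb * ?n ^ (m - 1) = ?n ^ m * X"
      unfolding Eb_def X_def nm by (simp add: algebra_simps)
    define u where "u \<tau>0 = card {\<tau> \<in> ?T. C (\<tau>0 ` ?M) \<noteq> C (\<tau> ` ?M)}" for \<tau>0
    define Good where "Good = ?T - Exc"
    have cGood: "card Good = ?n ^ m - card Exc"
      unfolding Good_def using card_Diff_subset[OF fin(3) ExcT] cT by simp
    then have Gpos: "?n ^ m < 2 * card Good" using False by linarith
    then have "Good \<noteq> {}" by auto
    \<comment> \<open>Averaging: the pairs with different centres number at most
      \<open>m * (?n ^ m * X)\<close>, and more than half of all tuples are in \<open>Good\<close>,
      so a minimal \<open>u \<tau>0\<close> is at most \<open>2 * m * X\<close>.\<close>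
    then obtain \<tau>0 where \<tau>0: "\<tau>0 \<in> Good" "\<And>\<tau>. \<tau> \<in> Good \<Longrightarrow> u \<tau>0 \<le> u \<tau>"
      using ex_has_least_nat[of "\<lambda>\<tau>. \<tau> \<in> Good" _ u] by blast
    have "of_nat (card Good) * u \<tau>0 \<le> (\<Sum>\<tau>\<in>Good. u \<tau>)"
      by (rule sum_bounded_below) (rule \<tau>0(2))
    also have "\<dots> = card (SIGMA \<tau>:Good. {\<tau>' \<in> ?T. C (\<tau> ` ?M) \<noteq> C (\<tau>' ` ?M)})"
      using finT by (simp add: u_def Good_def)
    also have "\<dots> \<le> card \<Delta>"
    proof (rule card_mono)
      show "finite \<Delta>" by (rule finite_subset[of _ "?T \<times> ?T"]) (use finT in \<open>auto simp: \<Delta>_def\<close>)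
    qed (auto simp: \<Delta>_def Good_def)
    finally have "card Good * u \<tau>0 \<le> m * (?n ^ m * X)" using c\<Delta> EbX by simp
    then have "?n ^ m * u \<tau>0 \<le> ?n ^ m * (2 * m * X)"
    proof -
      assume A: "card Good * u \<tau>0 \<le> m * (?n ^ m * X)"
      have "?n ^ m * u \<tau>0 \<le> 2 * card Good * u \<tau>0" using Gpos by (intro mult_le_mono1) simp
      also have "\<dots> \<le> 2 * (m * (?n ^ m * X))" using A by simp
      finally show ?thesis by (simp add: mult_ac)
    qed
    moreover have "0 < ?n ^ m" using False by linarith
    ultimately have u: "u \<tau>0 \<le> 2 * m * X" by (simp only: mult_le_cancel1)
    define S where "S = C (\<tau>0 ` ?M)"
    have S: "S \<subseteq> W" "card S = t - 1" using CW \<tau>0(1) by (auto simp: S_def Good_def Exc_def)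
    define H' where "H' = {e \<in> H. e \<inter> S = {}}"
    have "card H' \<le> fact m * card H'" by simp
    also have "\<dots> = (\<Sum>\<sigma>\<in>?T. card (centres H' ctr (\<sigma> ` ?M)))"
      by (rule sum_card_centres[OF W, symmetric]) (use H ctr m in \<open>auto simp: H'_def\<close>)
    \<comment> \<open>An edge that misses \<open>S\<close> has its centre outside \<open>S\<close>,
      so it can only be counted at tuples whose centres differ from those of
      \<open>\<tau>0\<close>.\<close>
    also have "\<dots> \<le> (\<Sum>\<sigma>\<in>?T. if S \<noteq> C (\<sigma> ` ?M) then K else 0)"
    proof (rule sum_mono)
      fix \<sigma>
      have sub: "centres H' ctr (\<sigma> ` ?M) \<subseteq> C (\<sigma> ` ?M)" by (auto simp: C_def centres_def H'_def)
      have "centres H' ctr (\<sigma> ` ?M) \<inter> S = {}" by (auto simp: centres_def H'_def)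
      then have "centres H' ctr (\<sigma> ` ?M) = {}" if "S = C (\<sigma> ` ?M)" using sub that by blast
      moreover have "card (centres H' ctr (\<sigma> ` ?M)) \<le> K"
        using card_mono[OF finC sub] CK[of "\<sigma> ` ?M"] by simp
      ultimately show "card (centres H' ctr (\<sigma> ` ?M)) \<le> (if S \<noteq> C (\<sigma> ` ?M) then K else 0)" by auto
    qed
    also have "\<dots> = K * u \<tau>0" unfolding sumI u_def S_def ..
    also have "\<dots> \<le> K * (2 * m * X)" using u by (rule mult_le_mono2)
    finally have "card H' \<le> 2 * K * m * X" by (simp add: mult_ac)
    then show ?thesis using S unfolding H'_def X_def by blast
  qed
  then show ?thesis using weight cBig by blast
qed

section \<open>Asymptotics\<close>

lemma tendsto_0_mult_smallo:
  fixes h g :: "'a \<Rightarrow> real"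
  assumes "(h \<longlongrightarrow> 0) F"
  shows "(\<lambda>x. h x * g x) \<in> o[F](g)"
proof (rule landau_o.smallI)
  fix c :: real assume c: "0 < c"
  have "eventually (\<lambda>x. norm (h x) < c) F"
    using tendstoD[OF assms c] by (simp add: dist_norm)
  then show "eventually (\<lambda>x. norm (h x * g x) \<le> c * norm (g x)) F"
    by eventually_elim (simp add: abs_mult mult_right_mono)
qed

lemma const_mult_smallo:
  fixes c :: real
  shows "f \<in> o[F](g) \<Longrightarrow> (\<lambda>x. c * f x) \<in> o[F](g)"
  by (cases "c = 0") auto

text \<open>Edges are measured by binomial coefficients and tuples by powers of \<open>n\<close>.
  The falling factorial differs from the power by the factor made up of the
  \<open>1 - i / n\<close>, which tends to 1.\<close>

lemma power_minus_fact_binomial_smallo: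
  "(\<lambda>n. real n ^ m - fact m * real (n choose m)) \<in> o(\<lambda>n. real n ^ m)"
proof -
  define h where "h n = 1 - (\<Prod>i\<in>{0..<m}. 1 - real i / real n)" for n :: nat
  have "(\<lambda>n. real i / real n) \<longlonglongrightarrow> 0" for i :: nat by real_asymp
  then have "h \<longlonglongrightarrow> 1 - (\<Prod>i\<in>{0..<m}. 1 - 0)"
    unfolding h_def by (intro tendsto_diff tendsto_prod tendsto_const)
  then have h0: "h \<longlonglongrightarrow> 0" by simp
  have "h n * real n ^ m = real n ^ m - fact m * real (n choose m)" if "n > 0" for n
  proof -
    have "fact m * real (n choose m) = (\<Prod>i\<in>{0..<m}. real n - real i)"
      using gbinomial_mult_fact[of m "real n"] by (simp add: binomial_gbinomial)
    also have "\<dots> = (\<Prod>i\<in>{0..<m}. real n * (1 - real i / real n))"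
      using that by (intro prod.cong) (auto simp: field_simps)
    also have "\<dots> = real n ^ m * (\<Prod>i\<in>{0..<m}. 1 - real i / real n)" by (simp add: prod.distrib)
    finally show ?thesis by (simp add: h_def algebra_simps)
  qed
  then have "eventually (\<lambda>n. h n * real n ^ m = real n ^ m - fact m * real (n choose m)) sequentially"
    by (intro eventually_mono[OF eventually_gt_at_top[of 0]]) blast
  from landau_o.small.in_cong[OF this, of "\<lambda>n. real n ^ m"] tendsto_0_mult_smallo[OF h0, of "\<lambda>n. real n ^ m"]
  show ?thesis by blast
qed

theorem theorem4:
  fixes a b r s t :: nat
    and T :: "'v pair_pre_digraph" and U V :: "'v set"
    and W :: "nat \<Rightarrow> 'w set" and H :: "nat \<Rightarrow> 'w set set"
  assumes "a > 0" and "b > 0" and "s > 0" and "t > 0"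
    and "r = a + b" and "b < a" and "a < r - 1" and "t \<le> s"
    and "undirected_tree T" and "bipartition T U V" and "card U = s" and "card V = t"
    and "\<exists>x. critical_leaf T V x"
    and "\<And>n. uniform_hypergraph r (W n) (H n)"
    and "\<And>n. card (W n) = n"
    and "\<And>n. blowup_free a b T U V (W n) (H n)"
    and "(\<lambda>n. real (card (H n))) \<sim>[at_top] (\<lambda>n. (real t - 1) * real (n choose (r - 1)))"
  shows "\<exists>S :: nat \<Rightarrow> 'w set.
           (\<forall>n \<ge> t - 1. S n \<subseteq> W n \<and> card (S n) = t - 1) \<and>
           (\<lambda>n. real (card {e \<in> H n. e \<inter> S n = {}})) \<in> o(\<lambda>n. real n ^ (r - 1))"
proof -
  obtain x where x: "critical_leaf T V x" using assms(13) by blast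
  define m where "m = r - 1"
  have m: "Suc m = a + b" "2 \<le> b" "0 < m" using assms(1-7) by (auto simp: m_def)
  define K where "K = card U * a + card V * b"
  define \<kappa> where "\<kappa> = hom_const (Suc (m + t)) (2 * Suc (m + t) + card U * a + card V * b) + 2 * K + 1"
  have W: "finite (W n)" for n using assms(14)[of n] by (simp add: uniform_hypergraph_def)
  have H: "e \<subseteq> W n \<and> card e = a + b" if "e \<in> H n" for e n
    using assms(14)[of n] that assms(5) by (simp add: uniform_hypergraph_def)
  define good where "good n S \<longleftrightarrow> S \<subseteq> W n \<and> card S = t - 1 \<and> (\<exists>Big Exc.
      card {e \<in> H n. e \<inter> S = {}} \<le> 2 * K * m * (2 * Exc + \<kappa> * n ^ (m - 1)) \<and>
      fact m * card (H n) + Exc \<le> (t - 1) * n ^ m + (K + 1) * Big \<and>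
      2 * sqrt n * real Big \<le> (1 + real \<kappa>) * real n ^ m)" for n S
  \<comment> \<open>For \<open>n < t - 1\<close> no set of \<open>t - 1\<close> vertices exists;
    these finitely many values do not affect the asymptotics.\<close>
  have "\<exists>S. n \<ge> t - 1 \<longrightarrow> good n S" for n
  proof (cases "n \<ge> t - 1")
    case True
    have "\<exists>S\<subseteq>W n. card S = t - 1 \<and> (\<exists>Big Exc.
      card {e \<in> H n. e \<inter> S = {}} \<le> 2 * K * m * (2 * Exc + \<kappa> * card (W n) ^ (m - 1)) \<and>
      fact m * card (H n) + Exc \<le> (t - 1) * card (W n) ^ m + (K + 1) * Big \<and>
      2 * sqrt (card (W n)) * real Big \<le> (1 + real \<kappa>) * real (card (W n)) ^ m)"
      by (rule star_approximation_count[OF assms(9,10) x W _ assms(16,12,4) _ assms(6) m(2,1) K_def \<kappa>_def])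
        (use H True assms(15) in auto)
    then show ?thesis unfolding good_def assms(15) by blast
  qed simp
  then obtain S where S: "\<And>n. n \<ge> t - 1 \<Longrightarrow> good n (S n)" by metis
  \<comment> \<open>\<open>g\<close> is the deficiency of the edge count, measured in tuples, and is
    of lower order by the hypothesis on \<open>card (H n)\<close>. The other two terms of
    \<open>R\<close> are of the orders \<open>n ^ m / sqrt n\<close>, coming from
    \<open>Big\<close>, and \<open>n ^ (m - 1)\<close>.\<close>
  define g where "g n = real (t - 1) * real n ^ m - fact m * real (card (H n))" for n
  define R where "R n = real (2 * K * m) * (2 * g n +
      (real (K + 1) * (1 + real \<kappa>)) * (1 / sqrt n * real n ^ m) + real \<kappa> * (1 / real n * real n ^ m))" for n
  have bound: "real (card {e \<in> H n. e \<inter> S n = {}}) \<le> R n" if n: "n \<ge> t - 1" "n > 0" for n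
  proof -
    obtain Big Exc where
      A: "card {e \<in> H n. e \<inter> S n = {}} \<le> 2 * K * m * (2 * Exc + \<kappa> * n ^ (m - 1))" and
      B: "fact m * card (H n) + Exc \<le> (t - 1) * n ^ m + (K + 1) * Big" and
      C: "2 * sqrt n * real Big \<le> (1 + real \<kappa>) * real n ^ m"
      using S[OF n(1)] unfolding good_def by blast
    have "real (fact m * card (H n) + Exc) \<le> real ((t - 1) * n ^ m + (K + 1) * Big)"
      using B by (rule of_nat_mono)
    moreover have "real (fact m * card (H n) + Exc) = fact m * real (card (H n)) + real Exc" by simp
    moreover have "real ((t - 1) * n ^ m + (K + 1) * Big) = real (t - 1) * real n ^ m + real (K + 1) * real Big"
      by (simp only: of_nat_add of_nat_mult of_nat_power)
    ultimately have E: "real Exc \<le> g n + real (K + 1) * real Big"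
      unfolding g_def by linarith
    have "2 * real Big \<le> (1 + real \<kappa>) * (1 / sqrt n * real n ^ m)"
      using C n(2) by (simp add: field_simps)
    then have "real (K + 1) * (2 * real Big) \<le> real (K + 1) * ((1 + real \<kappa>) * (1 / sqrt n * real n ^ m))"
      by (rule mult_left_mono) simp
    then have E2: "2 * real Exc \<le> 2 * g n + (real (K + 1) * (1 + real \<kappa>)) * (1 / sqrt n * real n ^ m)"
      using E by (simp only: mult.assoc)
    have P: "real n ^ (m - 1) = 1 / real n * real n ^ m"
      using m(3) n(2) by (simp add: power_eq_if)
    have "real (card {e \<in> H n. e \<inter> S n = {}}) \<le> real (2 * K * m * (2 * Exc + \<kappa> * n ^ (m - 1)))"
      using A by (rule of_nat_mono)
    also have "\<dots> = real (2 * K * m) * (2 * real Exc + real \<kappa> * (1 / real n * real n ^ m))"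
      unfolding P[symmetric] by simp
    also have "\<dots> \<le> R n" unfolding R_def using E2 by (intro mult_left_mono add_right_mono) auto
    finally show ?thesis .
  qed
  have "(\<lambda>n. real (card (H n)) - (real t - 1) * real (n choose m)) \<in> o(\<lambda>n. (real t - 1) * real (n choose m))"
    using asymp_equiv_imp_diff_smallo[OF assms(17)] by (simp add: m_def)
  also have "(\<lambda>n. (real t - 1) * real (n choose m)) \<in> O(\<lambda>n. real n ^ m)"
  proof (rule bigoI)
    have "real (n choose m) \<le> real n ^ m" for n
    proof -
      have "n choose m \<le> (n choose m) * fact m" by simp
      also have "\<dots> \<le> n ^ m" by (rule binomial_fact_pow)
      finally show ?thesis by (metis of_nat_le_iff of_nat_power)
    qed
    then show "eventually (\<lambda>n. norm ((real t - 1) * real (n choose m)) \<le> \<bar>real t - 1\<bar> * norm (real n ^ m)) sequentially"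
      by (intro always_eventually) (simp add: abs_mult mult_left_mono)
  qed
  finally have d1: "(\<lambda>n. real (card (H n)) - (real t - 1) * real (n choose m)) \<in> o(\<lambda>n. real n ^ m)" .
  have t1: "real (t - 1) = real t - 1" using assms(4) by simp
  have g_eq: "g = (\<lambda>n. (real t - 1) * (real n ^ m - fact m * real (n choose m)) -
      fact m * (real (card (H n)) - (real t - 1) * real (n choose m)))"
    unfolding g_def t1 by (simp add: algebra_simps)
  have g_small: "g \<in> o(\<lambda>n. real n ^ m)"
    unfolding g_eq
    by (intro sum_in_smallo const_mult_smallo power_minus_fact_binomial_smallo d1) 
  have "(\<lambda>n. 1 / sqrt (real n)) \<longlonglongrightarrow> 0" "(\<lambda>n. 1 / real n) \<longlonglongrightarrow> 0" by real_asymp+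
  note lims = this[THEN tendsto_0_mult_smallo, of "\<lambda>n. real n ^ m"]
  have R_small: "R \<in> o(\<lambda>n. real n ^ m)"
    unfolding R_def by (intro sum_in_smallo const_mult_smallo g_small lims)
  have "eventually (\<lambda>n. n \<ge> t - 1 \<and> n > 0) sequentially"
    by (intro eventually_conj eventually_ge_at_top eventually_gt_at_top)
  then have "(\<lambda>n. real (card {e \<in> H n. e \<inter> S n = {}})) \<in> O(R)"
    by (intro landau_o.big_mono) (elim eventually_mono, use bound in fastforce)
  then have "(\<lambda>n. real (card {e \<in> H n. e \<inter> S n = {}})) \<in> o(\<lambda>n. real n ^ m)"
    using R_small by (rule landau_o.big_small_trans)
  moreover have "\<forall>n \<ge> t - 1. S n \<subseteq> W n \<and> card (S n) = t - 1" using S by (simp add: good_def)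
  ultimately show ?thesis unfolding m_def by blast
qed

end
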